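(* Let $k$ be a field of characteristic zero, $n\ge1$, and $A_{2n}(k)$ the Weyl algebra in the variables $x_1,\dots,x_{2n},\partial_1,\dots,\partial_{2n}$. If $p_1,\dots,p_n,q_1,\dots,q_n$ are in the subalgebra generated by $x_1,\dots,x_n,\partial_1,\dots,\partial_n$, then the left ideal $$J=(x_{n+1}-q_1,\dots,x_{2n}-q_n,\ \partial_{n+1}+p_1,\dots,\partial_{2n}+p_n)$$ of $A_{2n}(k)$ is proper if and only if $$[q_i,q_j]=0,\qquad[p_i,p_j]=0,\qquad[p_i,q_j]=\delta_{ij}$$ for all $i,j=1,\dots,n$.
   Context: The Weyl algebra $A_m(k)$ is the $k$-algebra generated by $x_1,\dots,x_m,\partial_1,\dots,\partial_m$ with relations $[x_i,x_j]=0$, $[\partial_i,\partial_j]=0$, $[\partial_i,x_j]=\delta_{ij}$. Parentheses denote the left ideal generated by the listed elements; $J$ is proper if $J\neq A_{2n}(k)$. *)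

theory Defs
  imports "HOL.Hull" "HOL-Library.Poly_Mapping"
begin

section \<open>Ideals, subalgebras and commutators\<close>

definition left_ideal :: "'a::ring_1 set \<Rightarrow> bool" where
  "left_ideal I \<longleftrightarrow>
     0 \<in> I \<and> (\<forall>a\<in>I. \<forall>b\<in>I. a + b \<in> I) \<and> (\<forall>r. \<forall>a\<in>I. r * a \<in> I)"

definition two_sided_ideal :: "'a::ring_1 set \<Rightarrow> bool" where
  "two_sided_ideal I \<longleftrightarrow> left_ideal I \<and> (\<forall>r. \<forall>a\<in>I. a * r \<in> I)"

definition commutator :: "'a::ring_1 \<Rightarrow> 'a \<Rightarrow> 'a" where
  "commutator a b = a * b - b * a"

lemma left_ideal_hull: "left_ideal (left_ideal hull S)"
  by (rule hull_in) (auto simp: left_ideal_def)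

lemma two_sided_ideal_hull: "two_sided_ideal (two_sided_ideal hull S)"
  by (rule hull_in) (auto simp: two_sided_ideal_def left_ideal_def)


section \<open>The free associative algebra\<close>

text \<open>
  Words get a type of their own because the multiplication of \<^typ>\<open>'a \<Rightarrow>\<^sub>0 'b\<close> is the
  convolution with respect to the additive structure of \<^typ>\<open>'a\<close>. Hence
  \<open>'g word \<Rightarrow>\<^sub>0 'k\<close> is the monoid algebra of the free monoid on \<open>'g\<close>, that is, the free
  associative unital \<open>'k\<close>-algebra on \<open>'g\<close>.
\<close>

datatype 'g word = Word (letters: "'g list")

instantiation word :: (type) monoid_add
begin

definition zero_word :: "'a word" where "0 = Word []"

definition plus_word :: "'a word \<Rightarrow> 'a word \<Rightarrow> 'a word" where
  "u + v = Word (letters u @ letters v)"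

instance
  by standard (simp_all add: zero_word_def plus_word_def)

end

definition free_gen :: "'g \<Rightarrow> ('g word \<Rightarrow>\<^sub>0 'k::comm_ring_1)" where
  "free_gen g = Poly_Mapping.single (Word [g]) 1"

definition free_const :: "'k::comm_ring_1 \<Rightarrow> ('g word \<Rightarrow>\<^sub>0 'k)" where
  "free_const c = Poly_Mapping.single 0 c"


section \<open>The Weyl algebra\<close>

text \<open>\<open>GX i\<close> and \<open>GD i\<close> are the letters for $x_i$ and $\partial_i$.\<close>

datatype 'i weyl_gen = GX 'i | GD 'i

definition weyl_relators :: "('i weyl_gen word \<Rightarrow>\<^sub>0 'k::comm_ring_1) set" where
  "weyl_relators =
     {commutator (free_gen (GX i)) (free_gen (GX j)) | i j. True} \<union>
     {commutator (free_gen (GD i)) (free_gen (GD j)) | i j. True} \<union>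
     {commutator (free_gen (GD i)) (free_gen (GX j)) - (if i = j then 1 else 0) | i j. True}"

definition weyl_cong ::
  "('i weyl_gen word \<Rightarrow>\<^sub>0 'k::comm_ring_1) \<Rightarrow> ('i weyl_gen word \<Rightarrow>\<^sub>0 'k) \<Rightarrow> bool" where
  "weyl_cong a b \<longleftrightarrow> a - b \<in> two_sided_ideal hull weyl_relators"

lemma two_sided_idealD:
  assumes "two_sided_ideal I"
  shows "0 \<in> I" "a \<in> I \<Longrightarrow> b \<in> I \<Longrightarrow> a + b \<in> I" "a \<in> I \<Longrightarrow> r * a \<in> I"
    "a \<in> I \<Longrightarrow> a * r \<in> I" "a \<in> I \<Longrightarrow> - a \<in> I"
proof -
  show "a \<in> I \<Longrightarrow> - a \<in> I"
    using assms mult_minus1[of a] unfolding two_sided_ideal_def left_ideal_def by metis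
qed (use assms in \<open>auto simp: two_sided_ideal_def left_ideal_def\<close>)

lemmas weyl_idealD = two_sided_idealD[OF two_sided_ideal_hull[of weyl_relators]]

lemma weyl_cong_equivp: "equivp weyl_cong"
proof (rule equivpI)
  show "reflp weyl_cong"
    by (auto intro!: reflpI simp: weyl_cong_def weyl_idealD)
  show "symp weyl_cong"
    using weyl_idealD(5) by (fastforce intro!: sympI simp: weyl_cong_def)
  show "transp weyl_cong"
    using weyl_idealD(2) by (fastforce intro!: transpI simp: weyl_cong_def)
qed

text \<open>
  For a finite index type \<open>'i\<close> with \<open>m\<close> elements, \<open>('i, 'k) weyl\<close> is the Weyl algebra
  $A_m(k)$, with variables indexed by \<open>'i\<close> instead of $1,\dots,m$.
  With index type \<open>'n + 'n\<close>, where \<open>'n\<close> has $n$ elements, it is $A_{2n}(k)$: \<open>Inl\<close> indexes the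
  variables $1,\dots,n$ and \<open>Inr\<close> the variables $n+1,\dots,2n$.
\<close>

quotient_type (overloaded) ('i, 'k) weyl = "'i weyl_gen word \<Rightarrow>\<^sub>0 'k::comm_ring_1" / weyl_cong
  by (rule weyl_cong_equivp)

text \<open>
  To see that the quotient is not the zero ring, let the free algebra act on formal power
  series, given by their coefficient functions.
\<close>

fun gen_act :: "'i weyl_gen \<Rightarrow> (('i \<Rightarrow> nat) \<Rightarrow> 'k::comm_ring_1) \<Rightarrow> ('i \<Rightarrow> nat) \<Rightarrow> 'k" where
  "gen_act (GX i) f e = (if e i = 0 then 0 else f (e(i := e i - 1)))"
| "gen_act (GD i) f e = of_nat (e i + 1) * f (e(i := e i + 1))"

definition word_act ::
  "'i weyl_gen word \<Rightarrow> (('i \<Rightarrow> nat) \<Rightarrow> 'k::comm_ring_1) \<Rightarrow> ('i \<Rightarrow> nat) \<Rightarrow> 'k" where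
  "word_act w f = foldr gen_act (letters w) f"

definition free_act ::
  "('i weyl_gen word \<Rightarrow>\<^sub>0 'k::comm_ring_1) \<Rightarrow> (('i \<Rightarrow> nat) \<Rightarrow> 'k) \<Rightarrow> ('i \<Rightarrow> nat) \<Rightarrow> 'k" where
  "free_act a f e = (\<Sum>w\<in>Poly_Mapping.keys a. Poly_Mapping.lookup a w * word_act w f e)"

lemma gen_act_sum:
  "gen_act g (\<lambda>e. \<Sum>j\<in>A. c j * h j e) e = (\<Sum>j\<in>A. c j * gen_act g (h j) e)"
  by (cases g) (auto simp: sum_distrib_left algebra_simps)

lemma word_act_sum:
  "word_act w (\<lambda>e. \<Sum>j\<in>A. c j * h j e) e = (\<Sum>j\<in>A. c j * word_act w (h j) e)"
proof -
  have "foldr gen_act gs (\<lambda>e. \<Sum>j\<in>A. c j * h j e) =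
      (\<lambda>e. \<Sum>j\<in>A. c j * foldr gen_act gs (h j) e)" for gs
    by (induction gs) (auto simp: gen_act_sum)
  then show ?thesis by (simp add: word_act_def)
qed

lemma word_act_plus: "word_act (u + v) f = word_act u (word_act v f)"
  by (simp add: word_act_def plus_word_def)

lemma free_act_add: "free_act (a + b) f e = free_act a f e + free_act b f e"
  unfolding free_act_def by (rule setsum_keys_plus_distrib) (auto simp: algebra_simps)

lemma free_act_0: "free_act 0 f e = 0"
  by (simp add: free_act_def)

lemma free_act_diff: "free_act (a - b) f e = free_act a f e - free_act b f e"
  using free_act_add[of "a - b" b f e] by simp

lemma free_act_single: "free_act (Poly_Mapping.single w c) f e = c * word_act w f e"
  by (simp add: free_act_def)

lemma free_act_sum: "free_act (\<Sum>j\<in>A. a j) f e = (\<Sum>j\<in>A. free_act (a j) f e)"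
  by (induction A rule: infinite_finite_induct) (auto simp: free_act_add free_act_0)

lemma sum_singles:
  "a = (\<Sum>w\<in>Poly_Mapping.keys a. Poly_Mapping.single w (Poly_Mapping.lookup a w))"
  by (rule poly_mapping_eqI) (auto simp: lookup_sum lookup_single when_def in_keys_iff)

lemma free_act_mult: "free_act (a * b) f e = free_act a (free_act b f) e"
proof -
  have "a * b = (\<Sum>u\<in>Poly_Mapping.keys a. \<Sum>v\<in>Poly_Mapping.keys b.
      Poly_Mapping.single (u + v) (Poly_Mapping.lookup a u * Poly_Mapping.lookup b v))"
    by (subst sum_singles[of a], subst sum_singles[of b])
      (simp only: sum_distrib_left sum_distrib_right mult_single sum.swap[of _ "Poly_Mapping.keys b"])
  then have "free_act (a * b) f e = (\<Sum>u\<in>Poly_Mapping.keys a. \<Sum>v\<in>Poly_Mapping.keys b.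
      Poly_Mapping.lookup a u * Poly_Mapping.lookup b v * word_act u (word_act v f) e)"
    by (simp add: free_act_sum free_act_single word_act_plus)
  also have "\<dots> = (\<Sum>u\<in>Poly_Mapping.keys a. Poly_Mapping.lookup a u * word_act u (free_act b f) e)"
    by (simp add: free_act_def[abs_def] word_act_sum sum_distrib_left mult.assoc)
  finally show ?thesis by (simp add: free_act_def)
qed

lemma free_act_one: "free_act 1 f e = f e"
  by (metis free_act_single single_one mult_1 word_act_def zero_word_def word.sel foldr.simps(1) id_apply)

lemma free_act_gen: "free_act (free_gen g) f = gen_act g f"
  by (rule ext) (simp add: free_gen_def free_act_single word_act_def)

lemma free_act_relator:
  assumes "a \<in> weyl_relators"
  shows "free_act a f e = 0"
  using assms unfolding weyl_relators_def
  by (auto simp: commutator_def free_act_diff free_act_mult free_act_gen free_act_one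
      free_act_0 fun_upd_twist, simp add: distrib_right)

lemma one_notin_weyl_ideal:
  "(1 :: 'i weyl_gen word \<Rightarrow>\<^sub>0 'k::comm_ring_1) \<notin> two_sided_ideal hull weyl_relators"
proof
  let ?N = "{a :: 'i weyl_gen word \<Rightarrow>\<^sub>0 'k. \<forall>f e. free_act a f e = 0}"
  have zero: "free_act a (\<lambda>e. 0) e = 0" for a :: "'i weyl_gen word \<Rightarrow>\<^sub>0 'k" and e
    using free_act_mult[of a 0 "\<lambda>e. 0" e] by (simp add: free_act_0 free_act_0[abs_def])
  have "two_sided_ideal ?N"
  proof -
    have "free_act (r * a) f e = 0" if "\<forall>f e. free_act a f e = 0"
      for r a :: "'i weyl_gen word \<Rightarrow>\<^sub>0 'k" and f e
    proof -
      have "free_act a f = (\<lambda>e. 0)" using that by auto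
      then show ?thesis by (simp add: free_act_mult zero)
    qed
    then show ?thesis
      by (auto simp: two_sided_ideal_def left_ideal_def free_act_0 free_act_add free_act_mult)
  qed
  moreover assume "(1 :: 'i weyl_gen word \<Rightarrow>\<^sub>0 'k) \<in> two_sided_ideal hull weyl_relators"
  ultimately have "(1 :: 'i weyl_gen word \<Rightarrow>\<^sub>0 'k) \<in> ?N"
    using hull_minimal[of weyl_relators ?N two_sided_ideal] free_act_relator by blast
  then show False
    using free_act_one[of "\<lambda>e::'i \<Rightarrow> nat. 1 :: 'k" undefined] by auto
qed

instantiation weyl :: (type, comm_ring_1) ring_1
begin

lift_definition zero_weyl :: "('a, 'b) weyl" is 0 .

lift_definition one_weyl :: "('a, 'b) weyl" is 1 .

lift_definition plus_weyl :: "('a, 'b) weyl \<Rightarrow> ('a, 'b) weyl \<Rightarrow> ('a, 'b) weyl" is "(+)"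
proof -
  fix a a' b b' :: "'a weyl_gen word \<Rightarrow>\<^sub>0 'b"
  assume "weyl_cong a a'" "weyl_cong b b'"
  moreover have "a + b - (a' + b') = (a - a') + (b - b')"
    by (simp add: algebra_simps)
  ultimately show "weyl_cong (a + b) (a' + b')"
    unfolding weyl_cong_def by (simp only: weyl_idealD)
qed

lift_definition uminus_weyl :: "('a, 'b) weyl \<Rightarrow> ('a, 'b) weyl" is uminus
  unfolding weyl_cong_def using weyl_idealD(5) by fastforce

lift_definition minus_weyl :: "('a, 'b) weyl \<Rightarrow> ('a, 'b) weyl \<Rightarrow> ('a, 'b) weyl" is "(-)"
proof -
  fix a a' b b' :: "'a weyl_gen word \<Rightarrow>\<^sub>0 'b"
  assume "weyl_cong a a'" "weyl_cong b b'"
  moreover have "a - b - (a' - b') = (a - a') + - (b - b')"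
    by (simp add: algebra_simps)
  ultimately show "weyl_cong (a - b) (a' - b')"
    unfolding weyl_cong_def by (simp only: weyl_idealD)
qed

lift_definition times_weyl :: "('a, 'b) weyl \<Rightarrow> ('a, 'b) weyl \<Rightarrow> ('a, 'b) weyl" is "(*)"
proof -
  fix a a' b b' :: "'a weyl_gen word \<Rightarrow>\<^sub>0 'b"
  assume "weyl_cong a a'" "weyl_cong b b'"
  moreover have "a * b - a' * b' = (a - a') * b + a' * (b - b')"
    by (simp add: algebra_simps)
  ultimately show "weyl_cong (a * b) (a' * b')"
    unfolding weyl_cong_def by (simp only: weyl_idealD)
qed

instance
proof
  show "(0 :: ('a, 'b) weyl) \<noteq> 1"
  proof (transfer, rule notI)
    assume "weyl_cong (0 :: 'a weyl_gen word \<Rightarrow>\<^sub>0 'b) 1"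
    then show False
      using weyl_idealD(5)[of "0 - 1 :: 'a weyl_gen word \<Rightarrow>\<^sub>0 'b"] one_notin_weyl_ideal
      by (auto simp: weyl_cong_def)
  qed
qed (transfer, simp add: weyl_cong_def weyl_idealD algebra_simps)+

end

lift_definition weyl_x :: "'i \<Rightarrow> ('i, 'k::comm_ring_1) weyl" is "\<lambda>i. free_gen (GX i)" .

lift_definition weyl_d :: "'i \<Rightarrow> ('i, 'k::comm_ring_1) weyl" is "\<lambda>i. free_gen (GD i)" .

text \<open>The structure map of the \<open>'k\<close>-algebra; scalar multiplication by \<open>c\<close> is
  multiplication by \<open>weyl_const c\<close>.\<close>

lift_definition weyl_const :: "'k::comm_ring_1 \<Rightarrow> ('i, 'k) weyl" is free_const .

lemma weyl_const_0 [simp]: "weyl_const 0 = 0"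
  by transfer (simp add: free_const_def weyl_cong_def weyl_idealD)

lemma weyl_const_1 [simp]: "weyl_const 1 = 1"
  by transfer (simp add: free_const_def weyl_cong_def weyl_idealD)

lemma weyl_const_add: "weyl_const (a + b) = weyl_const a + weyl_const b"
  by transfer (simp add: free_const_def single_add weyl_cong_def weyl_idealD)

lemma weyl_const_mult: "weyl_const (a * b) = weyl_const a * weyl_const b"
  by transfer (simp add: free_const_def mult_single weyl_cong_def weyl_idealD)

lemma weyl_const_central: "weyl_const c * a = a * weyl_const c"
proof transfer
  fix c :: 'b and a :: "'a weyl_gen word \<Rightarrow>\<^sub>0 'b"
  have "free_const c * a = a * free_const c"
    by (subst (1 2) sum_singles[of a])
      (simp add: free_const_def sum_distrib_left sum_distrib_right mult_single mult.commute)
  then show "weyl_cong (free_const c * a) (a * free_const c)"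
    by (simp add: weyl_cong_def weyl_idealD)
qed

lemma weyl_relations:
  "commutator (weyl_x i) (weyl_x j) = (0 :: ('i, 'k::comm_ring_1) weyl)"
  "commutator (weyl_d i) (weyl_d j) = (0 :: ('i, 'k) weyl)"
  "commutator (weyl_d i) (weyl_x j) = (if i = j then 1 else 0 :: ('i, 'k) weyl)"
proof -
  have rel: "abs_weyl a = 0" if "a \<in> weyl_relators" for a :: "'i weyl_gen word \<Rightarrow>\<^sub>0 'k"
    using that by (simp add: zero_weyl_def weyl.abs_eq_iff weyl_cong_def hull_inc)
  have comm: "commutator (abs_weyl a) (abs_weyl b) = abs_weyl (commutator a b)"
    for a b :: "'i weyl_gen word \<Rightarrow>\<^sub>0 'k"
    by (simp add: commutator_def times_weyl.abs_eq minus_weyl.abs_eq)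
  show "commutator (weyl_x i) (weyl_x j) = (0 :: ('i, 'k) weyl)"
    unfolding weyl_x.abs_eq comm by (rule rel) (auto simp: weyl_relators_def)
  show "commutator (weyl_d i) (weyl_d j) = (0 :: ('i, 'k) weyl)"
    unfolding weyl_d.abs_eq comm by (rule rel) (auto simp: weyl_relators_def)
  have "abs_weyl (commutator (free_gen (GD i)) (free_gen (GX j)) - (if i = j then 1 else 0)) =
      (0 :: ('i, 'k) weyl)"
    by (rule rel) (unfold weyl_relators_def, blast)
  then show "commutator (weyl_d i) (weyl_x j) = (if i = j then 1 else 0 :: ('i, 'k) weyl)"
    unfolding weyl_d.abs_eq weyl_x.abs_eq comm minus_weyl.abs_eq[symmetric]
    by (auto simp flip: one_weyl_def zero_weyl_def split: if_splits)
qed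

definition subalgebra :: "('i, 'k::comm_ring_1) weyl set \<Rightarrow> bool" where
  "subalgebra B \<longleftrightarrow> range weyl_const \<subseteq> B \<and> (\<forall>a\<in>B. \<forall>b\<in>B. a + b \<in> B \<and> a * b \<in> B)"

end

theory Submission
  imports Defs "HOL-Library.FuncSet" "HOL-Library.Cardinality" "HOL.Vector_Spaces"
begin

text \<open>
  Let \<open>B\<close> be the subalgebra generated by the first \<open>n\<close> pairs of variables. The commutation defects
  of the \<open>q i\<close> and \<open>p i\<close> are commutators of the generators of \<open>J\<close>, so they lie in \<open>J \<inter> B\<close>, and
  properness of \<open>J\<close> forces \<open>J \<inter> B = 0\<close> by a growth argument: modulo \<open>J\<close> every element is congruent to
  one of \<open>B\<close>, of comparable degree, and a nonzero element of \<open>J \<inter> B\<close> would make the dimensions of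
  \<open>A/J\<close> grow with degree at most \<open>2n - 1\<close>, whereas Bernstein's inequality demands at least \<open>2n\<close>.
  Conversely, under the relations the algebra acts on itself with the first \<open>n\<close> pairs of variables
  operating from the left and the other generators as right multiplications by \<open>q i\<close> and \<open>- p i\<close>;
  then \<open>J\<close> annihilates \<open>1\<close>.
\<close>

section \<open>Products of powers of commuting elements\<close>

lemma mult_of_nat_left_commute: "a * (of_nat n * b) = of_nat n * (a * (b::'a::ring_1))"
proof -
  have "a * of_nat n = of_nat n * a" by (rule mult_of_nat_commute[symmetric])
  then show ?thesis by (simp flip: mult.assoc)
qed

lemma commutes_prod_list_powers:
  fixes y :: "'i \<Rightarrow> 'a::ring_1"
  assumes "\<And>j. j \<in> set xs \<Longrightarrow> z * y j = y j * z"
  shows "z * prod_list (map (\<lambda>j. y j ^ e j) xs) = prod_list (map (\<lambda>j. y j ^ e j) xs) * z"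
  using assms
proof (induction xs)
  case (Cons j xs)
  have "z * y j ^ e j = y j ^ e j * z"
    using Cons.prems[of j] by (metis list.set_intros(1) power_commuting_commutes)
  then show ?case
    using Cons by simp (metis mult.assoc)
qed simp

lemma prod_list_powers_upd_other:
  "i \<notin> set xs \<Longrightarrow>
    prod_list (map (\<lambda>j. y j ^ (e(i := v)) j) xs) = prod_list (map (\<lambda>j. y j ^ e j) xs)"
  by (rule arg_cong[of _ _ prod_list]) (auto intro!: map_cong)

lemma mult_prod_list_powers:
  fixes y :: "'i \<Rightarrow> 'a::ring_1"
  assumes "\<And>i j. y i * y j = y j * y i" and "i \<in> set xs" "distinct xs"
  shows "y i * prod_list (map (\<lambda>j. y j ^ e j) xs) =
    prod_list (map (\<lambda>j. y j ^ (e(i := Suc (e i))) j) xs)"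
  using assms(2,3)
proof (induction xs)
  case (Cons j xs)
  show ?case
  proof (cases "i = j")
    case True
    then show ?thesis
      using Cons.prems prod_list_powers_upd_other[of i xs y e "Suc (e i)"]
      by (simp add: mult.assoc del: fun_upd_apply) (simp add: mult.assoc)
  next
    case False
    then have "y i * y j ^ e j = y j ^ e j * y i"
      by (metis assms(1) power_commuting_commutes)
    then show ?thesis
      using Cons False by simp (metis mult.assoc)
  qed
qed simp

lemma derivation_power:
  fixes y z :: "'a::ring_1"
  assumes "z * y = y * z + 1"
  shows "z * y ^ n = y ^ n * z + of_nat n * y ^ (n - 1)"
proof (induction n)
  case (Suc n)
  have "z * y ^ Suc n = (y * z + 1) * y ^ n"
    by (simp add: assms flip: mult.assoc)
  also have "\<dots> = y * (y ^ n * z + of_nat n * y ^ (n - 1)) + y ^ n"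
    by (simp add: distrib_right mult.assoc Suc)
  also have "y * (of_nat n * y ^ (n - 1)) = of_nat n * y ^ n"
    by (cases n) (simp_all add: mult_of_nat_left_commute del: of_nat_Suc)
  then have "y * (y ^ n * z + of_nat n * y ^ (n - 1)) + y ^ n =
      y ^ Suc n * z + of_nat (Suc n) * y ^ n"
    by (simp add: algebra_simps)
  finally show ?case by simp
qed simp

text \<open>Bracketing with \<open>z\<close> is a derivation that sends \<open>y i\<close> to 1 and
  the other \<open>y j\<close> to 0, so it differentiates the product in \<open>y i\<close>. It is
  used twice: with \<open>z = weyl_d i\<close> on powers of the positions, and with
  \<open>z = - weyl_x i\<close> on powers of the derivations.\<close>

lemma derivation_prod_list_powers:
  fixes y :: "'i \<Rightarrow> 'a::ring_1"
  assumes z: "z * y i = y i * z + 1" "\<And>j. j \<noteq> i \<Longrightarrow> z * y j = y j * z"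
    and "i \<in> set xs" "distinct xs"
  shows "z * prod_list (map (\<lambda>j. y j ^ e j) xs) =
    prod_list (map (\<lambda>j. y j ^ e j) xs) * z +
    of_nat (e i) * prod_list (map (\<lambda>j. y j ^ (e(i := e i - 1)) j) xs)"
  using assms(3,4)
proof (induction xs)
  case (Cons j xs)
  let ?P = "\<lambda>e. prod_list (map (\<lambda>j. y j ^ e j) xs)"
  show ?case
  proof (cases "i = j")
    case True
    then have "i \<notin> set xs" using Cons.prems by simp
    then have "z * ?P e = ?P e * z"
      by (intro commutes_prod_list_powers z) auto
    moreover have "z * (y i ^ e i * ?P e) = y i ^ e i * (z * ?P e) + of_nat (e i) * y i ^ (e i - 1) * ?P e"
      using derivation_power[OF z(1), of "e i"] by (simp add: distrib_right flip: mult.assoc)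
    ultimately show ?thesis
      using True prod_list_powers_upd_other[OF \<open>i \<notin> set xs\<close>, of y e "e i - 1"]
      by (simp add: mult.assoc del: fun_upd_apply) (simp add: mult.assoc)
  next
    case False
    then have zj: "z * y j ^ e j = y j ^ e j * z"
      by (metis z(2) power_commuting_commutes)
    have "z * (y j ^ e j * ?P e) = y j ^ e j * (z * ?P e)"
      using zj by (simp flip: mult.assoc)
    also have "\<dots> = y j ^ e j * ?P e * z + y j ^ e j * (of_nat (e i) * ?P (e(i := e i - 1)))"
      using Cons False by (simp add: distrib_left mult.assoc del: fun_upd_apply)
    also have "y j ^ e j * (of_nat (e i) * ?P (e(i := e i - 1))) =
        of_nat (e i) * (y j ^ e j * ?P (e(i := e i - 1)))"
      by (rule mult_of_nat_left_commute)
    finally show ?thesis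
      using False by simp
  qed
qed simp

section \<open>Monomials in the Weyl algebra\<close>

lemma UNIV_weyl_gen: "UNIV = range GX \<union> range GD"
proof -
  have "g \<in> range GX \<union> range GD" for g :: "'a weyl_gen"
    by (cases g) simp_all
  then show ?thesis by blast
qed

instance weyl_gen :: (finite) finite
  by standard (unfold UNIV_weyl_gen, intro finite_UnI finite_imageI finite)

lemma card_weyl_gen: "CARD(('i::finite) weyl_gen) = 2 * CARD('i)"
proof -
  have "CARD('i weyl_gen) = card (range GX \<union> range GD :: 'i weyl_gen set)"
    by (simp only: UNIV_weyl_gen)
  also have "\<dots> = card (range (GX :: 'i \<Rightarrow> _)) + card (range (GD :: 'i \<Rightarrow> _))"
    by (rule card_Un_disjoint) auto
  finally show ?thesis
    by (simp add: card_image inj_def)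
qed

text \<open>The index type carries no order, but a noncommutative product needs one; a fixed
  enumeration supplies it.\<close>

definition index_list :: "'i::finite list" where
  "index_list = (SOME xs. set xs = UNIV \<and> distinct xs)"

lemma index_list: "set (index_list :: 'i::finite list) = UNIV" "distinct (index_list :: 'i list)"
  using someI_ex[OF finite_distinct_list[of "UNIV :: 'i set"]] by (auto simp: index_list_def)

text \<open>Normally ordered monomials: all positions stand to the left of all derivations. A single
  exponent function on the letters allows both kinds to be treated uniformly.\<close>

definition monomial :: "(('i::finite) weyl_gen \<Rightarrow> nat) \<Rightarrow> ('i, 'k::comm_ring_1) weyl" where
  "monomial e = prod_list (map (\<lambda>i. weyl_x i ^ e (GX i)) index_list) *
     prod_list (map (\<lambda>i. weyl_d i ^ e (GD i)) index_list)"

fun gen :: "'i weyl_gen \<Rightarrow> ('i, 'k::comm_ring_1) weyl" where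
  "gen (GX i) = weyl_x i"
| "gen (GD i) = weyl_d i"

lemma weyl_commutes:
  "weyl_x i * weyl_x j = (weyl_x j * weyl_x i :: ('i, 'k::comm_ring_1) weyl)"
  "weyl_d i * weyl_d j = (weyl_d j * weyl_d i :: ('i, 'k) weyl)"
  "weyl_d i * weyl_x j = (weyl_x j * weyl_d i + (if i = j then 1 else 0) :: ('i, 'k) weyl)"
  using weyl_relations[of i j, where 'k = 'k] by (auto simp: commutator_def algebra_simps)

lemma monomial_0 [simp]: "monomial (\<lambda>g. 0) = 1"
  by (simp add: monomial_def map_replicate_const)

text \<open>A position is absorbed by its own power. A derivation first crosses the block of
  positions, which yields the correction term, and is then absorbed. At \<open>e (GX i) = 0\<close>
  the truncated exponent is harmless because its coefficient vanishes.\<close>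

lemma gen_mult_monomial:
  "gen g * monomial e = (monomial (e(g := Suc (e g))) +
    (case g of GX i \<Rightarrow> 0
     | GD i \<Rightarrow> of_nat (e (GX i)) * monomial (e(GX i := e (GX i) - 1))) :: ('i::finite, 'k::comm_ring_1) weyl)"
proof (cases g)
  case (GX i)
  have "weyl_x i * prod_list (map (\<lambda>j. weyl_x j ^ e (GX j)) index_list) =
      (prod_list (map (\<lambda>j. weyl_x j ^ (e(GX i := Suc (e (GX i)))) (GX j)) index_list) :: ('i, 'k) weyl)"
    by (subst mult_prod_list_powers[where e = "\<lambda>j. e (GX j)" and i = i])
      (auto simp: index_list weyl_commutes intro!: arg_cong[of _ _ prod_list] map_cong)
  then show ?thesis
    by (simp add: GX monomial_def flip: mult.assoc)
next
  case (GD i)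
  let ?X = "\<lambda>e. prod_list (map (\<lambda>j. weyl_x j ^ e (GX j)) index_list) :: ('i, 'k) weyl"
  let ?D = "\<lambda>e. prod_list (map (\<lambda>j. weyl_d j ^ e (GD j)) index_list) :: ('i, 'k) weyl"
  have X: "weyl_d i * ?X e = ?X e * weyl_d i + of_nat (e (GX i)) * ?X (e(GX i := e (GX i) - 1))"
    by (subst derivation_prod_list_powers[where e = "\<lambda>j. e (GX j)" and i = i])
      (auto simp: index_list weyl_commutes intro!: arg_cong[of _ _ prod_list] map_cong arg_cong2[of _ _ _ _ "(*)"])
  have D: "weyl_d i * ?D e = ?D (e(GD i := Suc (e (GD i))))"
    by (subst mult_prod_list_powers[where e = "\<lambda>j. e (GD j)" and i = i])
      (auto simp: index_list weyl_commutes intro!: arg_cong[of _ _ prod_list] map_cong)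
  have "weyl_d i * (?X e * ?D e) = ?X e * (weyl_d i * ?D e) +
      of_nat (e (GX i)) * ?X (e(GX i := e (GX i) - 1)) * ?D e"
    by (simp add: X distrib_right flip: mult.assoc)
  then show ?thesis
    unfolding D by (simp add: GD monomial_def mult.assoc)
qed

text \<open>The mirror image: now a position has to cross the block of derivations from the
  right.\<close>

lemma monomial_mult_gen:
  "monomial e * gen g = (monomial (e(g := Suc (e g))) +
    (case g of GX i \<Rightarrow> of_nat (e (GD i)) * monomial (e(GD i := e (GD i) - 1))
     | GD i \<Rightarrow> 0) :: ('i::finite, 'k::comm_ring_1) weyl)"
proof (cases g)
  case (GD i)
  let ?D = "\<lambda>e. prod_list (map (\<lambda>j. weyl_d j ^ e (GD j)) index_list) :: ('i, 'k) weyl"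
  have "?D e * weyl_d i = weyl_d i * ?D e"
    by (intro commutes_prod_list_powers[symmetric] weyl_commutes)
  also have "\<dots> = ?D (e(GD i := Suc (e (GD i))))"
    by (subst mult_prod_list_powers[where e = "\<lambda>j. e (GD j)" and i = i])
      (auto simp: index_list weyl_commutes intro!: arg_cong[of _ _ prod_list] map_cong)
  finally show ?thesis
    by (simp add: GD monomial_def mult.assoc)
next
  case (GX i)
  let ?X = "\<lambda>e. prod_list (map (\<lambda>j. weyl_x j ^ e (GX j)) index_list) :: ('i, 'k) weyl"
  let ?D = "\<lambda>e. prod_list (map (\<lambda>j. weyl_d j ^ e (GD j)) index_list) :: ('i, 'k) weyl"
  have "?X e * weyl_x i = weyl_x i * ?X e"
    by (intro commutes_prod_list_powers[symmetric] weyl_commutes)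
  also have "\<dots> = ?X (e(GX i := Suc (e (GX i))))"
    by (subst mult_prod_list_powers[where e = "\<lambda>j. e (GX j)" and i = i])
      (auto simp: index_list weyl_commutes intro!: arg_cong[of _ _ prod_list] map_cong)
  finally have X: "?X e * weyl_x i = ?X (e(GX i := Suc (e (GX i))))" .
  \<comment> \<open>The sign makes \<open>- weyl_x i\<close> fit the derivation rule, since
    [-x_i, d_i] = 1.\<close>
  have "- weyl_x i * ?D e = ?D e * - weyl_x i + of_nat (e (GD i)) * ?D (e(GD i := e (GD i) - 1))"
    by (subst derivation_prod_list_powers[where e = "\<lambda>j. e (GD j)" and i = i])
      (auto simp: index_list weyl_commutes intro!: arg_cong[of _ _ prod_list] map_cong arg_cong2[of _ _ _ _ "(*)"])
  then have D: "?D e * weyl_x i = weyl_x i * ?D e + of_nat (e (GD i)) * ?D (e(GD i := e (GD i) - 1))"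
    by (simp add: algebra_simps)
  have "?X e * ?D e * weyl_x i = ?X e * weyl_x i * ?D e +
      ?X e * (of_nat (e (GD i)) * ?D (e(GD i := e (GD i) - 1)))"
    by (simp add: mult.assoc D distrib_left)
  also have "?X e * (of_nat (e (GD i)) * ?D (e(GD i := e (GD i) - 1))) =
      of_nat (e (GD i)) * (?X e * ?D (e(GD i := e (GD i) - 1)))"
    by (rule mult_of_nat_left_commute)
  finally show ?thesis
    unfolding X by (simp add: GX monomial_def)
qed

section \<open>Bernstein's inequality\<close>

text \<open>Gaussian elimination, by induction on the set of equations: a nonzero coefficient of the
  new equation serves as pivot and eliminates one unknown.\<close>

lemma homogeneous_system_nontrivial_solution:
  fixes M :: "'a \<Rightarrow> 'b \<Rightarrow> 'k::field"
  assumes "finite K" "finite I" "card K < card I"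
  shows "\<exists>c. (\<exists>i\<in>I. c i \<noteq> 0) \<and> (\<forall>k\<in>K. (\<Sum>i\<in>I. c i * M i k) = 0)"
  using assms
proof (induction K arbitrary: I M rule: finite_induct)
  case empty
  then have "I \<noteq> {}" by auto
  then show ?case by (intro exI[of _ "\<lambda>_. 1"]) auto
next
  case (insert k K)
  show ?case
  proof (cases "\<forall>i\<in>I. M i k = 0")
    case True
    with insert.IH[of I M] insert.prems insert.hyps show ?thesis
      by auto
  next
    case False
    then obtain i0 where i0: "i0 \<in> I" "M i0 k \<noteq> 0" by auto
    define I' where "I' = I - {i0}"
    define M' where "M' i l = M i l - M i k / M i0 k * M i0 l" for i l
    have I: "I = insert i0 I'" "i0 \<notin> I'" "finite I'"
      using i0 insert.prems by (auto simp: I'_def)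
    then have "card K < card I'"
      using insert.prems insert.hyps by simp
    from insert.IH[OF I(3) this, of M'] obtain c
      where c: "\<exists>i\<in>I'. c i \<noteq> 0" "\<forall>l\<in>K. (\<Sum>i\<in>I'. c i * M' i l) = 0"
      by blast
    \<comment> \<open>The value at the pivot unknown is forced by equation \<open>k\<close>; with
      it, solutions of the reduced system \<open>M'\<close> solve the original one.\<close>
    define d where "d = c(i0 := - (\<Sum>i\<in>I'. c i * M i k) / M i0 k)"
    have d: "(\<Sum>i\<in>I. d i * M i l) =
        (\<Sum>i\<in>I'. c i * M i l) - (\<Sum>i\<in>I'. c i * M i k) / M i0 k * M i0 l" for l
    proof -
      have "(\<Sum>i\<in>I'. d i * M i l) = (\<Sum>i\<in>I'. c i * M i l)"
        using I by (intro sum.cong) (auto simp: d_def)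
      then show ?thesis
        using I by (simp add: d_def)
    qed
    have "(\<Sum>i\<in>I. d i * M i l) = (\<Sum>i\<in>I'. c i * M' i l)" for l
      unfolding d M'_def
      by (simp add: right_diff_distrib sum_subtractf sum_distrib_left sum_distrib_right
          sum_divide_distrib mult.assoc)
    moreover have "(\<Sum>i\<in>I. d i * M i k) = 0"
      using i0 by (simp add: d)
    moreover have "\<exists>i\<in>I. d i \<noteq> 0"
      using c(1) I by (auto simp: d_def)
    ultimately show ?thesis
      using c(2) by (intro exI[of _ d]) auto
  qed
qed

section \<open>Subspaces and spans in the Weyl algebra\<close>

global_interpretation weyl: vector_space "\<lambda>c (a :: ('i, 'k::field) weyl). weyl_const c * a"
  by standard (simp_all add: distrib_left distrib_right weyl_const_add weyl_const_mult mult.assoc)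

lemma weyl_const_of_nat: "weyl_const (of_nat n) = of_nat n"
  by (induction n) (simp_all add: weyl_const_add)

lemma left_idealD:
  assumes "left_ideal I"
  shows "0 \<in> I" "a \<in> I \<Longrightarrow> b \<in> I \<Longrightarrow> a + b \<in> I" "a \<in> I \<Longrightarrow> r * a \<in> I"
    "a \<in> I \<Longrightarrow> - a \<in> I" "a \<in> I \<Longrightarrow> b \<in> I \<Longrightarrow> a - b \<in> I"
proof -
  show *: "a + b \<in> I" if "a \<in> I" "b \<in> I" for a b
    using assms that by (auto simp: left_ideal_def)
  show **: "- a \<in> I" if "a \<in> I" for a
    using assms mult_minus1[of a] that unfolding left_ideal_def by metis
  show "a - b \<in> I" if "a \<in> I" "b \<in> I"
    using *[of a "- b"] ** that by simp
qed (use assms in \<open>auto simp: left_ideal_def\<close>)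

lemma subspace_left_ideal: "left_ideal I \<Longrightarrow> weyl.subspace I"
  by (simp add: weyl.subspace_def left_idealD)

lemma subspace_vimage_mult:
  assumes "weyl.subspace S"
  shows "weyl.subspace {v. a * v \<in> S}"
proof -
  have "a * (weyl_const c * v) = weyl_const c * (a * v)" for c v
    by (simp add: weyl_const_central mult.assoc)
  then show ?thesis
    using assms by (simp add: weyl.subspace_def distrib_left)
qed

lemma subspace_vimage_mult_right:
  "weyl.subspace S \<Longrightarrow> weyl.subspace {v. v * a \<in> S}"
  by (simp add: weyl.subspace_def distrib_right mult.assoc)

text \<open>Supplies coordinates modulo \<open>J\<close>, which become the entries of the linear
  system in Bernstein's inequality.\<close>

lemma span_Un_subspaceD:
  assumes "v \<in> weyl.span (B \<union> J)" "finite B" "weyl.subspace J"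
  shows "\<exists>f. v - (\<Sum>b\<in>B. weyl_const (f b) * b) \<in> J"
proof -
  from assms(1) obtain u z where "v = u + z" "u \<in> weyl.span B" "z \<in> weyl.span J"
    unfolding weyl.span_Un by auto
  moreover from this obtain f where "u = (\<Sum>b\<in>B. weyl_const (f b) * b)"
    using assms(2) by (auto simp: weyl.span_finite)
  moreover have "weyl.span J = J"
    using assms(3) by simp
  ultimately show ?thesis
    by (auto intro!: exI[of _ f])
qed

text \<open>The canonically conjugate partner of each letter, with the sign chosen so that
  bracketing with it differentiates in that letter.\<close>

fun conjugate_gen :: "'i weyl_gen \<Rightarrow> ('i, 'k::comm_ring_1) weyl" where
  "conjugate_gen (GX i) = weyl_d i"
| "conjugate_gen (GD i) = - weyl_x i"

lemma conjugate_gen_commutator: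
  "conjugate_gen g * monomial e - monomial e * conjugate_gen g =
    (of_nat (e g) * monomial (e(g := e g - 1)) :: ('i::finite, 'k::comm_ring_1) weyl)"
proof (cases g)
  case (GX i)
  then show ?thesis
    using gen_mult_monomial[of "GD i" e, where 'k = 'k] monomial_mult_gen[of e "GD i", where 'k = 'k]
    by simp
next
  case (GD i)
  then show ?thesis
    using gen_mult_monomial[of "GX i" e, where 'k = 'k] monomial_mult_gen[of e "GX i", where 'k = 'k]
    by simp
qed

text \<open>The conclusion rebinds \<open>g\<close>: the letter split off need not be the given one.
  Positions go first, and a derivation is taken only when no position is left, so that no correction
  term arises.\<close>

lemma monomial_eq_gen_mult:
  assumes "e g > 0"
  shows "\<exists>g e'. e = e'(g := Suc (e' g)) \<and> monomial e = gen g * (monomial e' :: ('i::finite, 'k::comm_ring_1) weyl)"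
proof (cases "\<exists>i. e (GX i) > 0")
  case True
  then obtain i where "e (GX i) > 0" by auto
  then show ?thesis
    by (intro exI[of _ "GX i"] exI[of _ "e(GX i := e (GX i) - 1)"]) (simp add: gen_mult_monomial fun_upd_idem del: gen.simps)
next
  case False
  then obtain i where "e (GD i) > 0"
    using assms by (cases g) auto
  then show ?thesis using False
    by (intro exI[of _ "GD i"] exI[of _ "e(GD i := e (GD i) - 1)"])
      (simp add: gen_mult_monomial fun_upd_idem del: gen.simps)
qed

lemma sum_upd_Suc: "(\<Sum>h\<in>UNIV. (e(g := Suc (e g))) h) = Suc (\<Sum>h\<in>UNIV. e h)"
  for e :: "'g::finite \<Rightarrow> nat"
  by (simp add: sum.remove[of UNIV g])

text \<open>Commuting with \<open>conjugate_gen g\<close> differentiates with respect to \<open>g\<close>, so in characteristic 0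
  an operator killing a long enough piece of a filtration can be reduced to a nonzero scalar.\<close>

lemma one_in_ideal_if_annihilator:
  fixes J :: "('i::finite, 'k::field_char_0) weyl set"
  assumes J: "left_ideal J"
    and V: "\<And>s v. v \<in> V s \<Longrightarrow> v \<in> V (Suc s)" "\<And>s v g. v \<in> V s \<Longrightarrow> gen g * v \<in> V (Suc s)"
      "\<And>s. 1 \<in> V s"
    and "finite E" "\<And>e. e \<in> E \<Longrightarrow> (\<Sum>g\<in>UNIV. e g) \<le> s" "\<exists>e\<in>E. c e \<noteq> 0"
    and "\<And>v. v \<in> V s \<Longrightarrow> (\<Sum>e\<in>E. weyl_const (c e) * monomial e) * v \<in> J"
  shows "1 \<in> J"
  using assms(5-)
proof (induction s arbitrary: E c)
  case 0
  then obtain e where e: "e \<in> E" "c e \<noteq> 0" by auto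
  have "e' = (\<lambda>g. 0)" if "e' \<in> E" for e'
    using 0(2)[OF that] by (simp add: fun_eq_iff)
  with e(1) have "E = {\<lambda>g. 0}" "e = (\<lambda>g. 0)" by auto
  with 0(4)[OF V(3)] have "weyl_const (c e) \<in> J" by simp
  then have "weyl_const (inverse (c e)) * weyl_const (c e) \<in> J"
    using J by (simp add: left_idealD)
  with e(2) show ?case by (simp flip: weyl_const_mult)
next
  case (Suc s)
  let ?a = "\<Sum>e\<in>E. weyl_const (c e) * monomial e :: ('i, 'k) weyl"
  show ?case
  proof (cases "\<exists>e\<in>E. c e \<noteq> 0 \<and> (\<exists>g. e g > 0)")
    \<comment> \<open>Only the constant monomial has a nonzero coefficient, so the operator is an
      invertible scalar.\<close>
    case False
    with Suc.prems(3) have 0: "(\<lambda>g. 0) \<in> E" "c (\<lambda>g. 0) \<noteq> 0"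
      by (metis ext gr_zeroI)+
    have "?a = (\<Sum>e\<in>{\<lambda>g. 0}. weyl_const (c e) * monomial e)"
    proof (rule sum.mono_neutral_right)
      show "\<forall>e\<in>E - {\<lambda>g. 0}. weyl_const (c e) * monomial e = (0 :: ('i, 'k) weyl)"
      proof
        fix e assume e: "e \<in> E - {\<lambda>g. 0}"
        then obtain g where "e g > 0" by (auto simp: fun_eq_iff)
        with e False show "weyl_const (c e) * monomial e = (0 :: ('i, 'k) weyl)" by auto
      qed
    qed (use Suc.prems 0 in auto)
    moreover have "?a \<in> J"
      using Suc.prems(4)[OF V(3)] by simp
    ultimately have "weyl_const (c (\<lambda>g. 0)) \<in> J" by simp
    then have "weyl_const (inverse (c (\<lambda>g. 0))) * weyl_const (c (\<lambda>g. 0)) \<in> J"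
      using J by (simp add: left_idealD)
    with 0(2) show ?thesis by (simp flip: weyl_const_mult)
  next
    case True
    then obtain e0 g where e0: "e0 \<in> E" "c e0 \<noteq> 0" "e0 g > 0" by auto
    \<comment> \<open>Differentiation in \<open>g\<close> lowers the exponent of \<open>g\<close> by
      one and multiplies by the old exponent; \<open>?c\<close> gives the new coefficients, indexed
      by the lowered exponents.\<close>
    let ?down = "\<lambda>e. e(g := e g - 1)"
    let ?up = "\<lambda>e. e(g := Suc (e g))"
    let ?E = "{e \<in> E. e g > 0}"
    let ?c = "\<lambda>e. c (?up e) * of_nat (Suc (e g))"
    let ?b = "conjugate_gen g :: ('i, 'k) weyl"
    have up: "?up (?down e) = e" if "e g > 0" for e
      using that by auto
    have inj: "inj_on ?down ?E"
      by (rule inj_on_inverseI[of _ ?up]) auto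
    have "?b * ?a - ?a * ?b = (\<Sum>e\<in>E. weyl_const (c e) * (?b * monomial e - monomial e * ?b))"
    proof -
      have "?b * (weyl_const (c e) * monomial e) = weyl_const (c e) * (?b * monomial e)" for e
        by (simp add: weyl_const_central mult.assoc)
      then show ?thesis
        by (simp add: sum_distrib_left sum_distrib_right sum_subtractf right_diff_distrib mult.assoc)
    qed
    also have "\<dots> = (\<Sum>e\<in>E. weyl_const (c e * of_nat (e g)) * monomial (?down e))"
      by (simp only: conjugate_gen_commutator weyl_const_mult weyl_const_of_nat mult.assoc)
    \<comment> \<open>Exponents with \<open>e g = 0\<close> contribute the coefficient 0; on the
      remaining ones \<open>?down\<close> is injective.\<close>
    also have "\<dots> = (\<Sum>e\<in>?E. weyl_const (c e * of_nat (e g)) * monomial (?down e))"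
      using Suc.prems(1) by (intro sum.mono_neutral_right) auto
    also have "\<dots> = (\<Sum>e\<in>?down ` ?E. weyl_const (?c e) * monomial e)"
      unfolding sum.reindex[OF inj] o_def by (intro sum.cong refl) (simp add: up del: of_nat_Suc)
    finally have a': "?b * ?a - ?a * ?b = (\<Sum>e\<in>?down ` ?E. weyl_const (?c e) * monomial e)" .
    show ?thesis
    proof (rule Suc.IH[of "?down ` ?E" ?c])
      show "finite (?down ` ?E)" using Suc.prems(1) by simp
      show "(\<Sum>h\<in>UNIV. e h) \<le> s" if e: "e \<in> ?down ` ?E" for e
      proof -
        from e obtain e1 where e1: "e1 \<in> ?E" "e = ?down e1" by blast
        then have "(\<Sum>h\<in>UNIV. (?up e) h) \<le> Suc s"
          using Suc.prems(2)[of e1] up[of e1] by simp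
        then show ?thesis by (simp only: sum_upd_Suc)
      qed
      \<comment> \<open>Characteristic 0 keeps this coefficient nonzero.\<close>
      have "?c (?down e0) \<noteq> 0" using e0 up[of e0] by (simp del: of_nat_Suc)
      with e0 show "\<exists>e\<in>?down ` ?E. ?c e \<noteq> 0" by blast
      \<comment> \<open>The derivative is a commutator of \<open>?b\<close> and \<open>?a\<close>.
        In one product \<open>?b\<close> moves \<open>v\<close> up one level before
        \<open>?a\<close> sends it into \<open>J\<close>; in the other \<open>?a\<close> sends
        \<open>v\<close> into \<open>J\<close> and the left ideal absorbs \<open>?b\<close>.\<close>
      fix v assume v: "v \<in> V s"
      have "?a * (gen h * v) \<in> J" for h
        by (intro Suc.prems(4) V v)
      then have "?a * (?b * v) \<in> J"
      proof (cases g)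
        case (GX i)
        with \<open>\<And>h. ?a * (gen h * v) \<in> J\<close>[of "GD i"] show ?thesis by simp
      next
        case (GD i)
        with left_idealD(4)[OF J \<open>\<And>h. ?a * (gen h * v) \<in> J\<close>[of "GX i"]] show ?thesis by simp
      qed
      moreover have "?b * (?a * v) \<in> J"
        by (intro left_idealD(3)[OF J] Suc.prems(4) V v)
      ultimately show "(\<Sum>e\<in>?down ` ?E. weyl_const (?c e) * monomial e) * v \<in> J"
        unfolding a'[symmetric] using left_idealD(5)[OF J] by (simp add: left_diff_distrib mult.assoc)
    qed
  qed
qed

text \<open>Let \<open>V s\<close> be the span of \<open>B s\<close> and \<open>J\<close>, and
  \<open>s = m * t\<close>. The \<open>(t + 1) ^ m\<close> monomials with all exponents at most
  \<open>t\<close> have degree at most \<open>s\<close>, so they map \<open>V s\<close> to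
  \<open>V (s + s)\<close>. Modulo \<open>J\<close> each is described by
  \<open>card (B s) * card (B (s + s))\<close> matrix entries. With fewer entries than monomials, a
  nontrivial combination would map \<open>V s\<close> into \<open>J\<close>, which the preceding
  lemma excludes.\<close>

lemma bernstein_inequality:
  fixes J :: "('i::finite, 'k::field_char_0) weyl set"
  assumes J: "left_ideal J" "1 \<notin> J"
    and B: "\<And>s. finite (B s)" "\<And>s. B s \<subseteq> B (Suc s)"
    and one: "\<And>s. 1 \<in> weyl.span (B s \<union> J)"
    and step: "\<And>s b g. b \<in> B s \<Longrightarrow> gen g * b \<in> weyl.span (B (Suc s) \<union> J)"
  defines "m \<equiv> 2 * CARD('i)"
  shows "(t + 1) ^ m \<le> card (B (m * t)) * card (B (m * t + m * t))"
proof (rule ccontr)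
  define s where "s = m * t"
  define V where "V s = weyl.span (B s \<union> J)" for s
  define I where "I = PiE UNIV (\<lambda>_ :: 'i weyl_gen. {..t})"
  assume "\<not> (t + 1) ^ m \<le> card (B (m * t)) * card (B (m * t + m * t))"
  moreover have "finite I" "card I = (t + 1) ^ m"
    by (simp_all add: I_def card_PiE card_weyl_gen m_def finite_PiE)
  ultimately have finite_I: "finite I" and card: "card (B s \<times> B (s + s)) < card I"
    by (simp_all add: s_def B card_cartesian_product)
  have V_mono: "V s \<subseteq> V (Suc s)" for s
    unfolding V_def using B(2)[of s] by (intro weyl.span_mono) auto
  have V_step: "gen g * v \<in> V (Suc s)" if "v \<in> V s" for g v s
  proof -
    have "V s \<subseteq> {v. gen g * v \<in> V (Suc s)}"
      unfolding V_def using step left_idealD(3)[OF J(1)]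
      by (intro weyl.span_minimal subspace_vimage_mult weyl.subspace_span) (auto intro: weyl.span_base)
    with that show ?thesis by auto
  qed
  have V_monomial: "monomial e * v \<in> V (r + n)"
    if "v \<in> V r" "(\<Sum>g\<in>UNIV. e g) \<le> n" for e v r n
    using that(2)
  proof (induction n arbitrary: e)
    case 0
    then have "e = (\<lambda>g. 0)" by (simp add: fun_eq_iff)
    with that(1) show ?case by simp
  next
    case (Suc n)
    show ?case
    proof (cases "\<exists>g. e g > 0")
      case True
      then obtain g e' where "e = e'(g := Suc (e' g))"
          "monomial e = gen g * (monomial e' :: ('i, 'k) weyl)"
        using monomial_eq_gen_mult by metis
      moreover from this(1) Suc.prems have "(\<Sum>g\<in>UNIV. e' g) \<le> n"
        by (simp only: sum_upd_Suc)
      ultimately show ?thesis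
        using V_step[OF Suc.IH[of e'], of g] by (simp add: mult.assoc del: fun_upd_apply)
    next
      case False
      then have "monomial e = (1 :: ('i, 'k) weyl)"
        by (metis monomial_0 ext gr_zeroI)
      moreover have "V r \<subseteq> V (r + n)" for n
        using V_mono by (induction n) auto
      ultimately show ?thesis
        using that(1) by (metis mult_1 subsetD)
    qed
  qed
  have degree: "(\<Sum>g\<in>UNIV. e g) \<le> s" if "e \<in> I" for e
  proof -
    have "(\<Sum>g\<in>UNIV. e g) \<le> (\<Sum>g\<in>(UNIV :: 'i weyl_gen set). t)"
      using that by (intro sum_mono) (auto simp: I_def)
    also have "\<dots> = s"
      by (simp add: s_def m_def card_weyl_gen)
    finally show ?thesis .
  qed
  have ex_f: "\<exists>f. monomial e * b - (\<Sum>l\<in>B (s + s). weyl_const (f l) * l) \<in> J" if "e \<in> I" "b \<in> B s" for e b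
  proof (rule span_Un_subspaceD[OF _ B(1) subspace_left_ideal[OF J(1)]])
    have "b \<in> V s"
      unfolding V_def using that(2) by (intro weyl.span_base) simp
    from V_monomial[OF this degree[OF that(1)]]
    show "monomial e * b \<in> weyl.span (B (s + s) \<union> J)"
      by (simp only: V_def)
  qed
  \<comment> \<open>\<open>f e b\<close> is a choice of coordinates of \<open>monomial e * b\<close>
    modulo \<open>J\<close>. In the linear system there is one unknown per exponent \<open>e\<close>
    and one equation per matrix entry \<open>(b, l)\<close>.\<close>
  define f where "f e b = (SOME f. monomial e * b - (\<Sum>l\<in>B (s + s). weyl_const (f l) * l) \<in> J)" for e b
  have f: "monomial e * b - (\<Sum>l\<in>B (s + s). weyl_const (f e b l) * l) \<in> J"
    if "e \<in> I" "b \<in> B s" for e b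
    using someI_ex[OF ex_f[OF that]] unfolding f_def .
  obtain c where c: "\<exists>e\<in>I. c e \<noteq> 0"
      "\<forall>(b, l)\<in>B s \<times> B (s + s). (\<Sum>e\<in>I. c e * f e b l) = 0"
    using homogeneous_system_nontrivial_solution[OF _ _ card, of "\<lambda>e (b, l). f e b l"] B(1) finite_I
    by (auto simp: case_prod_beta)
  let ?a = "\<Sum>e\<in>I. weyl_const (c e) * monomial e :: ('i, 'k) weyl"
  have a: "?a * b \<in> J" if "b \<in> B s" for b
  proof -
    have "(\<Sum>e\<in>I. weyl_const (c e) * (\<Sum>l\<in>B (s + s). weyl_const (f e b l) * l)) =
        (\<Sum>e\<in>I. \<Sum>l\<in>B (s + s). weyl_const (c e * f e b l) * l)"
      by (simp only: sum_distrib_left weyl_const_mult mult.assoc)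
    also have "\<dots> = (\<Sum>l\<in>B (s + s). \<Sum>e\<in>I. weyl_const (c e * f e b l) * l)"
      by (rule sum.swap)
    also have "\<dots> = (\<Sum>l\<in>B (s + s). weyl_const (\<Sum>e\<in>I. c e * f e b l) * l)"
      by (simp only: weyl.scale_sum_left)
    also have "\<dots> = 0"
    proof (intro sum.neutral ballI)
      fix l assume "l \<in> B (s + s)"
      with c(2) that have "(\<Sum>e\<in>I. c e * f e b l) = 0" by blast
      then show "weyl_const (\<Sum>e\<in>I. c e * f e b l) * l = 0" by (simp only: weyl_const_0 mult_zero_left)
    qed
    finally have "?a * b = (\<Sum>e\<in>I. weyl_const (c e) *
        (monomial e * b - (\<Sum>l\<in>B (s + s). weyl_const (f e b l) * l)))"
      by (simp add: right_diff_distrib sum_subtractf sum_distrib_right mult.assoc)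
    also have "\<dots> \<in> J"
      using f[OF _ that] left_idealD(3)[OF J(1)]
      by (intro weyl.subspace_sum subspace_left_ideal J) auto
    finally show ?thesis .
  qed
  have "?a * v \<in> J" if "v \<in> V s" for v
  proof -
    have "V s \<subseteq> {v. ?a * v \<in> J}"
      unfolding V_def using a left_idealD(3)[OF J(1)]
      by (intro weyl.span_minimal subspace_vimage_mult subspace_left_ideal J) auto
    with that show ?thesis by auto
  qed
  \<comment> \<open>The degree bound \<open>s\<close> of the operator is also the level that it
    sends into \<open>J\<close>, as the reduction to a scalar requires.\<close>
  then have "1 \<in> J"
    using V_mono V_step one c(1) degree
    by (intro one_in_ideal_if_annihilator[OF J(1), of V I s c]) (auto simp: V_def finite_I)
  with J(2) show False by simp
qed

section \<open>Weighted leading exponents\<close>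

definition exponents :: "'g set \<Rightarrow> ('g \<Rightarrow> nat) set" where
  "exponents H = {e. \<forall>g. g \<notin> H \<longrightarrow> e g = 0}"

definition weight :: "('g::finite \<Rightarrow> nat) \<Rightarrow> ('g \<Rightarrow> nat) \<Rightarrow> nat" where
  "weight w e = (\<Sum>g\<in>UNIV. w g * e g)"

text \<open>The strict bound lets \<open>below H w (weight w e)\<close> collect the terms lower than
  \<open>monomial e\<close>, and makes level 0 the zero space.\<close>

definition below :: "'i weyl_gen set \<Rightarrow> ('i weyl_gen \<Rightarrow> nat) \<Rightarrow> nat \<Rightarrow> ('i::finite, 'k::field) weyl set" where
  "below H w R = weyl.span (monomial ` {e \<in> exponents H. weight w e < R})"

lemma weight_0 [simp]: "weight w (\<lambda>g. 0) = 0"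
  by (simp add: weight_def)

lemma weight_upd_Suc: "weight w (e(g := Suc (e g))) = weight w e + w g"
  by (simp add: weight_def sum.remove[of UNIV g])

lemma weight_upd_minus_one: "weight w (e(g := e g - 1)) \<le> weight w e"
  unfolding weight_def by (intro sum_mono) simp

lemma le_weight:
  assumes "w g > 0"
  shows "e g \<le> weight w e"
proof -
  have "e g \<le> w g * e g" using assms by simp
  also have "\<dots> \<le> weight w e" unfolding weight_def by (intro member_le_sum) auto
  finally show ?thesis .
qed

text \<open>Induction on the letters, as in a positional number system: the new letter gets a weight
  larger than every partial weight occurring in \<open>A\<close>, so its exponent and the old
  partial weight are recovered as quotient and remainder. Injectivity will make the leading exponent
  of an element unique.\<close>

lemma weight_injective:
  fixes A :: "('g::finite \<Rightarrow> nat) set"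
  assumes "finite A"
  shows "\<exists>w. (\<forall>g. w g > 0) \<and> inj_on (weight w) A"
proof -
  have "\<exists>w. (\<forall>g. w g > (0::nat)) \<and> (\<forall>e\<in>A. \<forall>e'\<in>A. (\<Sum>g\<in>G. w g * e g) = (\<Sum>g\<in>G. w g * e' g) \<longrightarrow>
      (\<forall>g\<in>G. e g = e' g))" if "finite G" for G :: "'g set"
    using that
  proof (induction G rule: finite_induct)
    case empty
    show ?case by (intro exI[of _ "\<lambda>_. 1"]) simp
  next
    case (insert h G)
    then obtain w where w: "\<And>g. w g > (0::nat)"
      "\<And>e e'. e \<in> A \<Longrightarrow> e' \<in> A \<Longrightarrow> (\<Sum>g\<in>G. w g * e g) = (\<Sum>g\<in>G. w g * e' g) \<Longrightarrow> \<forall>g\<in>G. e g = e' g"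
      by metis
    define s where "s e = (\<Sum>g\<in>G. w g * e g)" for e
    define W where "W = Suc (\<Sum>e\<in>A. s e)"
    have less: "s e < W" if "e \<in> A" for e
      unfolding W_def less_Suc_eq_le using assms that by (intro member_le_sum) auto
    have sum: "(\<Sum>g\<in>insert h G. (w(h := W)) g * e g) = e h * W + s e" for e
    proof -
      have "(\<Sum>g\<in>G. (w(h := W)) g * e g) = s e"
        unfolding s_def using insert.hyps by (intro sum.cong) auto
      then show ?thesis using insert.hyps by simp
    qed
    have *: "\<forall>g\<in>insert h G. e g = e' g"
      if e: "e \<in> A" "e' \<in> A" and eq: "e h * W + s e = e' h * W + s e'" for e e'
    proof -
      have "(e h * W + s e) div W = (e' h * W + s e') div W" "(e h * W + s e) mod W = (e' h * W + s e') mod W"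
        by (simp_all only: eq)
      with less[OF e(1)] less[OF e(2)] have "e h = e' h" "s e = s e'"
        by simp_all
      with w(2)[OF e] show ?thesis by (simp add: s_def)
    qed
    have "\<forall>g. (w(h := W)) g > 0"
      by (simp add: w(1) W_def)
    moreover have "\<forall>e\<in>A. \<forall>e'\<in>A.
        (\<Sum>g\<in>insert h G. (w(h := W)) g * e g) = (\<Sum>g\<in>insert h G. (w(h := W)) g * e' g) \<longrightarrow>
        (\<forall>g\<in>insert h G. e g = e' g)"
      unfolding sum using * by blast
    ultimately show ?case by blast
  qed
  from this[of UNIV, OF finite] obtain w where "\<forall>g. w g > (0::nat)"
      "\<forall>e\<in>A. \<forall>e'\<in>A. weight w e = weight w e' \<longrightarrow> (\<forall>g. e g = e' g)"
    unfolding weight_def by auto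
  then show ?thesis
    by (intro exI[of _ w]) (auto simp: inj_on_def)
qed

section \<open>The filtration by weight\<close>

lemma exponents_upd: "e \<in> exponents H \<Longrightarrow> g \<in> H \<Longrightarrow> e(g := n) \<in> exponents H"
  by (auto simp: exponents_def)

lemma exponents_upd_minus_one: "e \<in> exponents H \<Longrightarrow> e(g := e g - 1) \<in> exponents H"
  by (auto simp: exponents_def)

lemma subspace_below: "weyl.subspace (below H w R)"
  by (simp add: below_def)

lemma below_mono: "R \<le> R' \<Longrightarrow> below H w R \<subseteq> below H w R'"
  unfolding below_def by (intro weyl.span_mono) auto

lemma monomial_in_below: "e \<in> exponents H \<Longrightarrow> weight w e < R \<Longrightarrow> monomial e \<in> below H w R"
  unfolding below_def by (intro weyl.span_base) auto

lemma one_in_below: "0 < R \<Longrightarrow> 1 \<in> below H w R"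
  using monomial_in_below[of "\<lambda>_. 0" H w R] by (simp add: exponents_def)

lemma below_subsetI:
  assumes "weyl.subspace S" "\<And>e. e \<in> exponents H \<Longrightarrow> weight w e < R \<Longrightarrow> monomial e \<in> S"
  shows "below H w R \<subseteq> S"
  unfolding below_def using assms by (intro weyl.span_minimal) auto

lemma of_nat_mult_in_below: "a \<in> below H w R \<Longrightarrow> of_nat n * a \<in> below H w R"
  using weyl.subspace_scale[OF subspace_below] by (metis weyl_const_of_nat)

text \<open>The correction term loses letters of \<open>e\<close> and does not gain
  \<open>g\<close>; as \<open>w g\<close> is positive, it is strictly lower than the leading
  term.\<close>

lemma gen_mult_monomial_leading:
  assumes "\<forall>g. w g > 0" "e \<in> exponents H"
  shows "gen g * monomial e - monomial (e(g := Suc (e g))) \<in> below H w (weight w e + w g)"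
proof (cases g)
  case (GX i)
  then show ?thesis
    using weyl.subspace_0[OF subspace_below] by (simp add: gen_mult_monomial del: gen.simps)
next
  case (GD i)
  have "weight w (e(GX i := e (GX i) - 1)) < weight w e + w g"
    using weight_upd_minus_one[of w e "GX i"] spec[OF assms(1), of g] by linarith
  then have "of_nat (e (GX i)) * monomial (e(GX i := e (GX i) - 1)) \<in> below H w (weight w e + w g)"
    using assms(2) by (intro of_nat_mult_in_below monomial_in_below exponents_upd_minus_one)
  then show ?thesis
    by (simp add: GD gen_mult_monomial del: gen.simps)
qed

lemma gen_mult_below:
  assumes w: "\<forall>g. w g > 0" and "g \<in> H" "a \<in> below H w R"
  shows "gen g * a \<in> below H w (R + w g)"
proof -
  have "below H w R \<subseteq> {a. gen g * a \<in> below H w (R + w g)}"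
  proof (intro below_subsetI subspace_vimage_mult subspace_below CollectI)
    fix e assume e: "e \<in> exponents H" "weight w e < R"
    then have "monomial (e(g := Suc (e g))) \<in> below H w (R + w g)"
      using assms(2) by (intro monomial_in_below exponents_upd) (simp_all add: weight_upd_Suc)
    moreover have "gen g * monomial e - monomial (e(g := Suc (e g))) \<in> below H w (R + w g)"
      using gen_mult_monomial_leading[OF w e(1), of g] below_mono[of "weight w e + w g" "R + w g" H w] e(2)
      by auto
    ultimately have "(gen g * monomial e - monomial (e(g := Suc (e g)))) + monomial (e(g := Suc (e g))) \<in> below H w (R + w g)"
      by (intro weyl.subspace_add subspace_below)
    then show "gen g * monomial e \<in> below H w (R + w g)" by simp
  qed
  with assms(3) show ?thesis by auto
qed

lemma below_mult_gen:
  assumes w: "\<forall>g. w g > 0" and "g \<in> H" "a \<in> below H w R"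
  shows "a * gen g \<in> below H w (R + w g)"
proof -
  have "below H w R \<subseteq> {a. a * gen g \<in> below H w (R + w g)}"
  proof (intro below_subsetI subspace_vimage_mult_right subspace_below CollectI)
    fix e assume e: "e \<in> exponents H" "weight w e < R"
    then have "monomial (e(g := Suc (e g))) \<in> below H w (R + w g)"
      using assms(2) by (intro monomial_in_below exponents_upd) (simp_all add: weight_upd_Suc)
    moreover have "of_nat (e h) * monomial (e(h := e h - 1)) \<in> below H w (R + w g)" for h
      using e weight_upd_minus_one[of w e h]
      by (intro of_nat_mult_in_below monomial_in_below exponents_upd_minus_one) auto
    ultimately show "monomial e * gen g \<in> below H w (R + w g)"
      unfolding monomial_mult_gen
      by (intro weyl.subspace_add subspace_below)
        (auto simp: weyl.subspace_0[OF subspace_below] simp del: One_nat_def split: weyl_gen.split)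
  qed
  with assms(3) show ?thesis by auto
qed

section \<open>Generated subalgebras and leading monomials\<close>

lemma subalgebra_hull_closed:
  "range weyl_const \<subseteq> subalgebra hull S"
  "a \<in> subalgebra hull S \<Longrightarrow> b \<in> subalgebra hull S \<Longrightarrow> a + b \<in> subalgebra hull S"
  "a \<in> subalgebra hull S \<Longrightarrow> b \<in> subalgebra hull S \<Longrightarrow> a * b \<in> subalgebra hull S"
proof -
  have "subalgebra (subalgebra hull S)"
    by (rule hull_in) (auto simp: subalgebra_def)
  then show "range weyl_const \<subseteq> subalgebra hull S"
    "a \<in> subalgebra hull S \<Longrightarrow> b \<in> subalgebra hull S \<Longrightarrow> a + b \<in> subalgebra hull S"
    "a \<in> subalgebra hull S \<Longrightarrow> b \<in> subalgebra hull S \<Longrightarrow> a * b \<in> subalgebra hull S"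
    by (simp_all add: subalgebra_def)
qed

text \<open>Negation is not built into \<open>subalgebra\<close>; the scalar -1 supplies it.\<close>

lemma subalgebra_hull_diff:
  assumes "a \<in> subalgebra hull S" "b \<in> subalgebra hull S"
  shows "a - b \<in> subalgebra hull S"
proof -
  have "weyl_const (- 1) + weyl_const 1 = (0 :: ('a, 'b) weyl)"
    unfolding weyl_const_add[symmetric] by simp
  then have "weyl_const (- 1) = (- 1 :: ('a, 'b) weyl)"
    by (simp add: eq_neg_iff_add_eq_0)
  moreover have "a + weyl_const (- 1) * b \<in> subalgebra hull S"
    using assms subalgebra_hull_closed(1)[of S] by (intro subalgebra_hull_closed) auto
  ultimately show ?thesis by simp
qed

text \<open>The elements that raise weights by a bounded amount, uniformly in \<open>R\<close>, form
  a subalgebra containing the generators from \<open>H\<close>; for products the bounds add up.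
  Right multiplication matters because modulo \<open>J\<close> the letters outside \<open>H\<close>
  will act in this way.\<close>

lemma below_mult_subalgebra:
  fixes b :: "('i::finite, 'k::field) weyl"
  assumes w: "\<forall>g. w g > 0" and "b \<in> subalgebra hull (gen ` H)"
  shows "\<exists>D. \<forall>R. \<forall>a\<in>below H w R. a * b \<in> below H w (R + D)"
proof -
  let ?T = "{b. \<exists>D. \<forall>R. \<forall>a\<in>below H w R. a * b \<in> below H w (R + D)} :: ('i, 'k) weyl set"
  have "subalgebra ?T"
    unfolding subalgebra_def
  proof (intro conjI ballI)
    show "range weyl_const \<subseteq> ?T"
      using weyl.subspace_scale[OF subspace_below, of _ H w]
      by (auto simp flip: weyl_const_central intro!: exI[of _ 0])
    fix a b :: "('i, 'k) weyl" assume "a \<in> ?T" "b \<in> ?T"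
    then obtain D E where "\<forall>R. \<forall>v\<in>below H w R. v * a \<in> below H w (R + D)"
      "\<forall>R. \<forall>v\<in>below H w R. v * b \<in> below H w (R + E)"
      by blast
    then have D: "v * a \<in> below H w (R + D)" and E: "v * b \<in> below H w (R + E)"
      if "v \<in> below H w R" for R v
      using that by simp_all
    have "v * (a + b) \<in> below H w (R + (D + E))" if "v \<in> below H w R" for v R
    proof -
      have "v * a \<in> below H w (R + (D + E))" "v * b \<in> below H w (R + (D + E))"
        using D[OF that] E[OF that] below_mono[of "R + D" "R + (D + E)" H w]
          below_mono[of "R + E" "R + (D + E)" H w] by auto
      then show ?thesis
        unfolding distrib_left by (intro weyl.subspace_add subspace_below)
    qed
    then show "a + b \<in> ?T" by blast
    have "v * (a * b) \<in> below H w (R + (D + E))" if "v \<in> below H w R" for v R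
      using E[OF D[OF that]] by (simp add: mult.assoc add.assoc)
    then show "a * b \<in> ?T" by blast
  qed
  moreover have "gen ` H \<subseteq> ?T"
    using below_mult_gen[where w = w, OF w] by blast
  ultimately have "subalgebra hull (gen ` H) \<subseteq> ?T"
    by (intro hull_minimal)
  with assms(2) show ?thesis by auto
qed

lemma subalgebra_subset_below:
  fixes b :: "('i::finite, 'k::field) weyl"
  assumes w: "\<forall>g. w g > 0" and "b \<in> subalgebra hull (gen ` H)"
  shows "\<exists>R. b \<in> below H w R"
proof -
  from below_mult_subalgebra[OF assms] obtain D
    where "\<And>R a. a \<in> below H w R \<Longrightarrow> a * b \<in> below H w (R + D)" by blast
  from this[of 1 1] one_in_below[of 1 H w] show ?thesis by auto
qed

text \<open>The weights are adapted to \<open>b\<close>: they separate the finitely many exponents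
  in an expansion of \<open>b\<close>, so a single term has maximal weight, and scaling makes its
  coefficient 1.\<close>

lemma leading_monomial:
  fixes b :: "('i::finite, 'k::field) weyl"
  assumes J: "left_ideal J" "b \<in> J" and b: "b \<in> subalgebra hull (gen ` H)" "b \<noteq> 0"
  shows "\<exists>w \<mu>. (\<forall>g. w g > 0) \<and> \<mu> \<in> exponents H \<and>
    (\<exists>z\<in>J. monomial \<mu> - z \<in> below H w (weight w \<mu>))"
proof -
  \<comment> \<open>Unit weights serve to obtain a finite expansion of \<open>b\<close>.\<close>
  obtain R where "b \<in> below H (\<lambda>_. 1) R"
    using subalgebra_subset_below[where w = "\<lambda>_. 1" and H = H and b = b] b by auto
  then obtain T c where T: "T \<subseteq> monomial ` {e \<in> exponents H. weight (\<lambda>_. 1) e < R}" "finite T"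
      and bT: "b = (\<Sum>a\<in>T. weyl_const (c a) * a)"
    unfolding below_def weyl.span_explicit by blast
  \<comment> \<open>One exponent is picked for each element of \<open>T\<close>, so that the sum can
    be reindexed injectively.\<close>
  from T(1) obtain E where E: "E \<subseteq> {e \<in> exponents H. weight (\<lambda>_. 1) e < R}"
      "inj_on (monomial :: _ \<Rightarrow> ('i, 'k) weyl) E" "T = monomial ` E"
    by (auto simp: subset_image_inj)
  define c' where "c' e = c (monomial e)" for e
  define E' where "E' = {e \<in> E. c' e \<noteq> 0}"
  have "finite E"
    using T(2) E by (simp add: finite_image_iff)
  have bE: "b = (\<Sum>e\<in>E'. weyl_const (c' e) * monomial e)"
  proof -
    have "b = (\<Sum>e\<in>E. weyl_const (c' e) * monomial e)"
      unfolding bT E(3) by (subst sum.reindex[OF E(2)]) (simp add: c'_def)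
    also have "\<dots> = (\<Sum>e\<in>E'. weyl_const (c' e) * monomial e)"
      using \<open>finite E\<close> by (intro sum.mono_neutral_right) (auto simp: E'_def)
    finally show ?thesis .
  qed
  have "finite E'" using \<open>finite E\<close> by (simp add: E'_def)
  obtain w where w: "\<forall>g. w g > 0" "inj_on (weight w) E'"
    using weight_injective[OF \<open>finite E'\<close>] by auto
  have "E' \<noteq> {}" using b(2) bE by auto
  then have "Max (weight w ` E') \<in> weight w ` E'"
    using \<open>finite E'\<close> by (intro Max_in) auto
  then obtain \<mu> where \<mu>: "\<mu> \<in> E'" "weight w \<mu> = Max (weight w ` E')"
    by auto
  have less: "weight w e < weight w \<mu>" if "e \<in> E' - {\<mu>}" for e
  proof -
    have "weight w e \<le> weight w \<mu>"
      using \<mu>(2) \<open>finite E'\<close> that by simp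
    moreover have "weight w e \<noteq> weight w \<mu>"
      using w(2) \<mu>(1) that by (auto dest: inj_onD)
    ultimately show ?thesis by simp
  qed
  define r where "r = (\<Sum>e\<in>E' - {\<mu>}. weyl_const (c' e) * monomial e :: ('i, 'k) weyl)"
  have r: "r \<in> below H w (weight w \<mu>)"
    unfolding r_def using less E(1)
    by (intro weyl.subspace_sum subspace_below weyl.subspace_scale[OF subspace_below] monomial_in_below)
      (auto simp: E'_def)
  have "b = weyl_const (c' \<mu>) * monomial \<mu> + r"
    unfolding bE r_def using \<mu>(1) \<open>finite E'\<close> by (simp add: sum.remove)
  moreover have "c' \<mu> \<noteq> 0" using \<mu>(1) by (simp add: E'_def)
  ultimately have "weyl_const (inverse (c' \<mu>)) * b =
      monomial \<mu> + weyl_const (inverse (c' \<mu>)) * r"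
    by (simp add: distrib_left flip: mult.assoc weyl_const_mult)
  then have "monomial \<mu> - weyl_const (inverse (c' \<mu>)) * b = - (weyl_const (inverse (c' \<mu>)) * r)"
    by simp
  also have "\<dots> \<in> below H w (weight w \<mu>)"
    by (intro weyl.subspace_neg weyl.subspace_scale subspace_below r)
  finally show ?thesis
    using w(1) \<mu>(1) E(1) left_idealD(3)[OF J, of "weyl_const (inverse (c' \<mu>))"]
    by (intro exI[of _ w] exI[of _ \<mu>]) (auto simp: E'_def)
qed

section \<open>Normal forms modulo a left ideal\<close>

text \<open>Standard monomials with respect to one leading exponent \<mu>, as in Groebner basis
  theory.\<close>

definition normal_exponents :: "'g set \<Rightarrow> ('g::finite \<Rightarrow> nat) \<Rightarrow> ('g \<Rightarrow> nat) \<Rightarrow> nat \<Rightarrow> ('g \<Rightarrow> nat) set" where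
  "normal_exponents H w \<mu> R = {e \<in> exponents H. weight w e < R \<and> \<not> (\<forall>g. \<mu> g \<le> e g)}"

text \<open>Failing divisibility leaves some coordinate \<open>h\<close> in \<open>H\<close> only
  \<mu> \<open>h\<close> values, while positive weights leave at most \<open>R\<close> values to
  each other coordinate in \<open>H\<close>. One power of \<open>R\<close> is lost, and this is what
  beats Bernstein's bound.\<close>

lemma normal_exponents_card:
  fixes H :: "'g::finite set"
  assumes w: "\<forall>g. w g > 0" and \<mu>: "\<mu> \<in> exponents H"
  shows "finite (normal_exponents H w \<mu> R)"
    "card (normal_exponents H w \<mu> R) \<le> (\<Sum>g\<in>H. \<mu> g) * R ^ (card H - 1)"
proof -
  let ?P = "\<lambda>h. PiE H ((\<lambda>_. {..<R})(h := {..<\<mu> h}))"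
  \<comment> \<open>Functions in \<open>PiE\<close> are \<open>undefined\<close> off
    \<open>H\<close>; they are extended by 0 instead.\<close>
  let ?ext = "\<lambda>f g. if g \<in> H then f g else 0 :: nat"
  have "normal_exponents H w \<mu> R \<subseteq> (\<Union>h\<in>H. ?ext ` ?P h)"
  proof
    fix e assume e: "e \<in> normal_exponents H w \<mu> R"
    then obtain h where h: "e h < \<mu> h"
      by (auto simp: normal_exponents_def not_le)
    then have "h \<in> H"
      using \<mu> by (auto simp: exponents_def)
    moreover have "e g < R" for g
      using e le_weight[of w g e] w by (auto simp: normal_exponents_def)
    then have "restrict e H \<in> ?P h"
      using h by auto
    moreover have "e = ?ext (restrict e H)"
      using e by (auto simp: normal_exponents_def exponents_def)
    ultimately show "e \<in> (\<Union>h\<in>H. ?ext ` ?P h)" by blast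
  qed
  moreover have fin: "finite (?P h)" for h
    by (intro finite_PiE) auto
  ultimately show "finite (normal_exponents H w \<mu> R)"
    by (meson finite_UN_I finite_imageI finite_subset finite)
  have "card (normal_exponents H w \<mu> R) \<le> card (\<Union>h\<in>H. ?ext ` ?P h)"
    using \<open>normal_exponents H w \<mu> R \<subseteq> _\<close> fin by (intro card_mono) auto
  also have "\<dots> \<le> (\<Sum>h\<in>H. card (?ext ` ?P h))"
    by (rule card_UN_le) simp
  also have "\<dots> \<le> (\<Sum>h\<in>H. \<mu> h * R ^ (card H - 1))"
  proof (intro sum_mono)
    fix h assume h: "h \<in> H"
    have "card (?ext ` ?P h) \<le> card (?P h)"
      using fin by (rule card_image_le)
    also have "\<dots> = (\<Prod>g\<in>H. card (((\<lambda>_. {..<R})(h := {..<\<mu> h})) g))"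
      by (rule card_PiE) simp
    also have "\<dots> = \<mu> h * (\<Prod>g\<in>H - {h}. R)"
      using h by (subst prod.remove[of H h]) (auto intro!: prod.cong)
    also have "\<dots> = \<mu> h * R ^ (card H - 1)"
      using h by (simp add: card_Diff_singleton)
    finally show "card (?ext ` ?P h) \<le> \<mu> h * R ^ (card H - 1)" .
  qed
  finally show "card (normal_exponents H w \<mu> R) \<le> (\<Sum>g\<in>H. \<mu> g) * R ^ (card H - 1)"
    by (simp add: sum_distrib_right)
qed

text \<open>The leading exponent climbs from \<mu> to \<open>e\<close> by left multiplication with
  one letter at a time; noncommutativity disturbs only lower terms.\<close>

lemma leading_monomial_multiple:
  fixes J :: "('i::finite, 'k::field) weyl set"
  assumes w: "\<forall>g. w g > 0" and J: "left_ideal J"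
    and \<mu>: "\<mu> \<in> exponents H" "z \<in> J" "monomial \<mu> - z \<in> below H w (weight w \<mu>)"
    and e: "e \<in> exponents H" "\<And>g. \<mu> g \<le> e g"
  shows "\<exists>z\<in>J. monomial e - z \<in> below H w (weight w e)"
  using e
proof (induction "\<Sum>g\<in>UNIV. e g" arbitrary: e rule: less_induct)
  case less
  show ?case
  proof (cases "e = \<mu>")
    case True
    with \<mu> show ?thesis by auto
  next
    case False
    then obtain g where g: "\<mu> g < e g"
      using less.prems(2) by (metis ext le_neq_implies_less)
    define e' where "e' = e(g := e g - 1)"
    have e: "e = e'(g := Suc (e' g))"
      using g by (auto simp: e'_def)
    have "g \<in> H" using g less.prems(1) by (auto simp: exponents_def)
    have e': "e' \<in> exponents H"
      unfolding e'_def by (intro exponents_upd_minus_one less.prems)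
    have "(\<Sum>h\<in>UNIV. e' h) < (\<Sum>h\<in>UNIV. e h)"
      by (subst e, subst sum_upd_Suc) simp
    moreover have "\<mu> h \<le> e' h" for h
      using g less.prems(2)[of h] by (auto simp: e'_def)
    ultimately obtain z' where z': "z' \<in> J" "monomial e' - z' \<in> below H w (weight w e')"
      using less.hyps e' by blast
    have "gen g * (monomial e' - z') \<in> below H w (weight w e' + w g)"
      by (intro gen_mult_below w z' \<open>g \<in> H\<close>)
    moreover have "gen g * monomial e' - monomial e \<in> below H w (weight w e' + w g)"
      by (subst e) (intro gen_mult_monomial_leading w e')
    ultimately have "gen g * (monomial e' - z') - (gen g * monomial e' - monomial e)
        \<in> below H w (weight w e' + w g)"
      by (rule weyl.subspace_diff[OF subspace_below])
    moreover have "weight w e = weight w e' + w g"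
      by (subst e) (rule weight_upd_Suc)
    ultimately have "monomial e - gen g * z' \<in> below H w (weight w e)"
      by (simp add: right_diff_distrib)
    then show ?thesis
      using left_idealD(3)[OF J z'(1)] by blast
  qed
qed

text \<open>Division with remainder by one element: a monomial divisible by the leading one is
  replaced modulo \<open>J\<close> by lower terms, to which the induction on \<open>R\<close>
  applies.\<close>

lemma below_subset_normal_span:
  fixes J :: "('i::finite, 'k::field) weyl set"
  assumes w: "\<forall>g. w g > 0" and J: "left_ideal J"
    and \<mu>: "\<mu> \<in> exponents H" "z \<in> J" "monomial \<mu> - z \<in> below H w (weight w \<mu>)"
  shows "below H w R \<subseteq> weyl.span (monomial ` normal_exponents H w \<mu> R \<union> J)"
proof (induction R)
  case 0
  show ?case by (rule below_subsetI) simp_all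
next
  case (Suc R)
  have mono: "weyl.span (monomial ` normal_exponents H w \<mu> R \<union> J) \<subseteq>
      weyl.span (monomial ` normal_exponents H w \<mu> (Suc R) \<union> J)"
    by (intro weyl.span_mono) (auto simp: normal_exponents_def)
  show ?case
  proof (intro below_subsetI weyl.subspace_span)
    fix e assume e: "e \<in> exponents H" "weight w e < Suc R"
    show "monomial e \<in> weyl.span (monomial ` normal_exponents H w \<mu> (Suc R) \<union> J)"
    proof (cases "\<forall>g. \<mu> g \<le> e g")
      case False
      with e show ?thesis
        by (intro weyl.span_base) (auto simp: normal_exponents_def)
    next
      case True
      then obtain z' where z': "z' \<in> J" "monomial e - z' \<in> below H w (weight w e)"
        using leading_monomial_multiple[OF w J \<mu> e(1)] by auto
      then have "monomial e - z' \<in> weyl.span (monomial ` normal_exponents H w \<mu> (Suc R) \<union> J)"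
        using Suc.IH mono below_mono[of "weight w e" R H w] e(2) by fastforce
      moreover have "z' \<in> weyl.span (monomial ` normal_exponents H w \<mu> (Suc R) \<union> J)"
        using z'(1) by (intro weyl.span_base) simp
      ultimately have "(monomial e - z') + z' \<in> weyl.span (monomial ` normal_exponents H w \<mu> (Suc R) \<union> J)"
        by (rule weyl.span_add)
      then show ?thesis by simp
    qed
  qed
qed

text \<open>The set of permitted letters is closed under taking conjugate partners, so neither
  \<open>g\<close> nor its partner occurs in the monomials and no correction term survives.\<close>

lemma gen_commutes_below:
  fixes a :: "('i::finite, 'k::field) weyl"
  assumes "a \<in> below (GX ` S \<union> GD ` S) w R" "g \<notin> GX ` S \<union> GD ` S"
  shows "gen g * a = a * gen g"
proof -
  have "below (GX ` S \<union> GD ` S) w R \<subseteq> {a. gen g * a - a * gen g = (0 :: ('i, 'k) weyl)}"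
  proof (rule below_subsetI)
    have "gen g * (weyl_const c * v) = weyl_const c * (gen g * v)" for c and v :: "('i, 'k) weyl"
      by (metis weyl_const_central mult.assoc)
    then show "weyl.subspace {a. gen g * a - a * gen g = (0 :: ('i, 'k) weyl)}"
      by (simp add: weyl.subspace_def distrib_left distrib_right mult.assoc)
    fix e :: "'i weyl_gen \<Rightarrow> nat" assume "e \<in> exponents (GX ` S \<union> GD ` S)"
    moreover have "i \<notin> S" if "g = GX i \<or> g = GD i" for i
      using assms(2) that by auto
    ultimately have i: "e (GX i) = 0" "e (GD i) = 0" if "g = GX i \<or> g = GD i" for i
      using that by (auto simp: exponents_def)
    show "monomial e \<in> {a. gen g * a - a * gen g = (0 :: ('i, 'k) weyl)}"
      using i by (cases g) (auto simp: gen_mult_monomial monomial_mult_gen simp del: gen.simps)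
  qed
  with assms(1) show ?thesis by auto
qed

text \<open>If some \<open>b \<noteq> 0\<close> lay in the intersection, normal forms would bound the growth of \<open>A/J\<close> by a
  polynomial of degree \<open>2 * card S - 1\<close>, less than Bernstein's lower bound \<open>CARD('i)\<close>.\<close>

lemma left_ideal_inter_subalgebra:
  fixes J :: "('i::finite, 'k::field_char_0) weyl set" and S :: "'i set"
  defines "H \<equiv> GX ` S \<union> GD ` S"
  assumes J: "left_ideal J" "1 \<notin> J" and S: "CARD('i) = 2 * card S"
    and gen: "\<And>g. g \<notin> H \<Longrightarrow> \<exists>r\<in>subalgebra hull (gen ` H). gen g - r \<in> J"
    and b: "b \<in> J" "b \<in> subalgebra hull (gen ` H)"
  shows "b = 0"
proof (rule ccontr)
  assume "b \<noteq> 0"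
  from leading_monomial[OF J(1) b this] obtain w \<mu> z
    where w: "\<forall>g. w g > 0"
      and \<mu>: "\<mu> \<in> exponents H" "z \<in> J" "monomial \<mu> - z \<in> below H w (weight w \<mu>)"
    by auto
  \<comment> \<open>Modulo \<open>J\<close> every letter raises weights by a bounded amount; letters
    outside \<open>H\<close> must first be replaced by their \<open>r\<close>.\<close>
  have "\<exists>d. \<forall>R. \<forall>v\<in>below H w R. gen g * v \<in> weyl.span (below H w (R + d) \<union> J)" for g
  proof (cases "g \<in> H")
    case True
    then show ?thesis
      using gen_mult_below[OF w True] by (blast intro: weyl.span_base)
  next
    case False
    then obtain r where r: "r \<in> subalgebra hull (gen ` H)" "gen g - r \<in> J"
      using gen by blast
    obtain d where d: "\<And>R v. v \<in> below H w R \<Longrightarrow> v * r \<in> below H w (R + d)"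
      using below_mult_subalgebra[OF w r(1)] by blast
    have "gen g * v \<in> weyl.span (below H w (R + d) \<union> J)" if "v \<in> below H w R" for v R
    proof -
      \<comment> \<open>Since \<open>gen g\<close> commutes with \<open>v\<close>, it can act from
        the right, where replacing it by \<open>r\<close> costs only a left multiple of
        \<open>gen g - r\<close>.\<close>
      have "gen g * v = v * r + v * (gen g - r)"
        using gen_commutes_below[of v S w R g] that False unfolding H_def
        by (simp add: right_diff_distrib)
      also have "\<dots> \<in> weyl.span (below H w (R + d) \<union> J)"
        using d[OF that] left_idealD(3)[OF J(1) r(2)]
        by (intro weyl.span_add weyl.span_base) auto
      finally show ?thesis .
    qed
    then show ?thesis by blast
  qed
  then obtain d where d: "\<And>g R v. v \<in> below H w R \<Longrightarrow>
      gen g * v \<in> weyl.span (below H w (R + d g) \<union> J)"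
    by metis
  \<comment> \<open>A bound that works for all letters at once.\<close>
  define D where "D = (\<Sum>g\<in>UNIV. d g)"
  have dD: "d g \<le> D" for g
    unfolding D_def by (intro member_le_sum) auto
  define N where "N R = (monomial ` normal_exponents H w \<mu> R :: ('i, 'k) weyl set)" for R
  define C where "C = (\<Sum>g\<in>H. \<mu> g)"
  define h where "h = card H"
  have N: "finite (N R)" "card (N R) \<le> C * R ^ (h - 1)" for R
  proof -
    note fin = normal_exponents_card[OF w \<mu>(1), of R]
    from fin show "finite (N R)" by (simp add: N_def)
    from card_image_le[OF fin(1)] fin(2) show "card (N R) \<le> C * R ^ (h - 1)"
      unfolding N_def C_def h_def by (rule le_trans)
  qed
  have below_N: "below H w R \<subseteq> weyl.span (N R \<union> J)" for R
    unfolding N_def by (rule below_subset_normal_span[OF w J(1) \<mu>])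
  have N_below: "N R \<subseteq> below H w R" for R
    unfolding N_def using monomial_in_below by (auto simp: normal_exponents_def)
  \<comment> \<open>\<open>H\<close> contains half of all letters, so \<open>h\<close> equals
    \<open>CARD('i)\<close>.\<close>
  have h: "2 * CARD('i) = 2 * h" "h > 0"
  proof -
    have "h = card (GX ` S) + card (GD ` S)"
      unfolding h_def H_def by (rule card_Un_disjoint) auto
    then show "2 * CARD('i) = 2 * h"
      using S by (simp add: card_image inj_on_def)
    then show "h > 0" using zero_less_card_finite[where 'a = 'i] by simp
  qed
  \<comment> \<open>One step of the filtration is worth \<open>D\<close> units of weight; the
    successor makes room for 1 at level 0.\<close>
  have bernstein: "(t + 1) ^ (2 * CARD('i)) \<le> card (N (Suc (D * (2 * CARD('i) * t)))) *
      card (N (Suc (D * (2 * CARD('i) * t + 2 * CARD('i) * t))))" for t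
  proof (rule bernstein_inequality[OF J, where B = "\<lambda>s. N (Suc (D * s))"])
    show "finite (N (Suc (D * s)))" for s by (rule N)
    show "N (Suc (D * s)) \<subseteq> N (Suc (D * Suc s))" for s
      by (auto simp: N_def normal_exponents_def)
    show "1 \<in> weyl.span (N (Suc (D * s)) \<union> J)" for s
      using below_N one_in_below[of "Suc (D * s)" H w] by blast
    fix s b g assume "b \<in> N (Suc (D * s))"
    then have "gen g * b \<in> weyl.span (below H w (Suc (D * s) + d g) \<union> J)"
      using d N_below by blast
    also have "\<dots> \<subseteq> weyl.span (N (Suc (D * Suc s)) \<union> J)"
    proof (intro weyl.span_minimal weyl.subspace_span Un_least)
      have "below H w (Suc (D * s) + d g) \<subseteq> below H w (Suc (D * Suc s))"
        using dD[of g] by (intro below_mono) simp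
      with below_N show "below H w (Suc (D * s) + d g) \<subseteq> weyl.span (N (Suc (D * Suc s)) \<union> J)"
        by blast
    qed (auto intro: weyl.span_base)
    finally show "gen g * b \<in> weyl.span (N (Suc (D * Suc s)) \<union> J)" .
  qed
  \<comment> \<open>The constants are fitted so that \<open>C * (Q * (t + 1)) ^ (h - 1)\<close>
    equals \<open>t * (t + 1) ^ (h - 1)\<close>, which falls short of \<open>(t + 1) ^ h\<close>.
    The larger of the two levels in Bernstein's inequality is \<open>4 * h * t\<close>.\<close>
  define Q where "Q = 4 * h * D + 1"
  define t where "t = C * Q ^ (h - 1)"
  have N_le: "card (N (Suc (D * r))) \<le> t * (t + 1) ^ (h - 1)" if "r \<le> 4 * h * t" for r
  proof -
    have "D * r \<le> D * (4 * h * t)"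
      using that by (rule mult_le_mono2)
    also have "D * (4 * h * t) = 4 * h * D * t" by (simp add: mult_ac)
    finally have "D * r \<le> 4 * h * D * t" .
    moreover have "Q * (t + 1) = 4 * h * D * t + 4 * h * D + t + 1"
      by (simp add: Q_def algebra_simps)
    ultimately have "Suc (D * r) \<le> Q * (t + 1)"
      by linarith
    then have "C * Suc (D * r) ^ (h - 1) \<le> C * (Q * (t + 1)) ^ (h - 1)"
      by (intro mult_le_mono2 power_mono) simp_all
    also have "\<dots> = t * (t + 1) ^ (h - 1)"
      by (simp only: t_def power_mult_distrib mult.assoc)
    finally show ?thesis
      using N(2)[of "Suc (D * r)"] by simp
  qed
  have less: "t * (t + 1) ^ (h - 1) < (t + 1) * (t + 1) ^ (h - 1)"
    by (intro mult_strict_right_mono) simp_all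
  have "(t + 1) ^ (2 * h) \<le> (t * (t + 1) ^ (h - 1)) * (t * (t + 1) ^ (h - 1))"
    using le_trans[OF bernstein[of t, unfolded h(1)] mult_le_mono[OF N_le N_le]] by simp
  also have "\<dots> < ((t + 1) * (t + 1) ^ (h - 1)) * ((t + 1) * (t + 1) ^ (h - 1))"
    by (intro mult_strict_mono[OF less less]) simp_all
  also have "\<dots> = (t + 1) ^ (2 * h)"
    using h(2) by (simp add: mult_2 power_add flip: power_Suc)
  finally show False by simp
qed

section \<open>Modules over the Weyl algebra\<close>

text \<open>The universal property of the presentation: linear operators obeying the defining
  relations extend to an action of the Weyl algebra. The space acted on is a Weyl algebra regarded
  as a mere vector space.\<close>

locale weyl_operators =
  fixes L :: "'i weyl_gen \<Rightarrow> ('j, 'k::field) weyl \<Rightarrow> ('j, 'k) weyl"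
  assumes add: "L g (u + v) = L g u + L g v"
    and scale: "L g (weyl_const c * v) = weyl_const c * L g v"
    and xx: "L (GX i) (L (GX j) v) = L (GX j) (L (GX i) v)"
    and dd: "L (GD i) (L (GD j) v) = L (GD j) (L (GD i) v)"
    and dx: "L (GD i) (L (GX j) v) = L (GX j) (L (GD i) v) + (if i = j then v else 0)"
begin

definition word_op :: "'i weyl_gen word \<Rightarrow> ('j, 'k) weyl \<Rightarrow> ('j, 'k) weyl" where
  "word_op w v = foldr L (letters w) v"

definition free_op :: "('i weyl_gen word \<Rightarrow>\<^sub>0 'k) \<Rightarrow> ('j, 'k) weyl \<Rightarrow> ('j, 'k) weyl" where
  "free_op a v = (\<Sum>w\<in>Poly_Mapping.keys a. weyl_const (Poly_Mapping.lookup a w) * word_op w v)"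

text \<open>The choice of representative is immaterial by \<open>weyl_op_abs\<close>.\<close>

definition weyl_op :: "('i, 'k) weyl \<Rightarrow> ('j, 'k) weyl \<Rightarrow> ('j, 'k) weyl" where
  "weyl_op a = free_op (rep_weyl a)"

lemma zero: "L g 0 = 0"
  using add[of g 0 0] by simp

lemma word_op_sum:
  "word_op w (\<Sum>j\<in>A. weyl_const (c j) * h j) = (\<Sum>j\<in>A. weyl_const (c j) * word_op w (h j))"
proof -
  have L_sum: "L g (\<Sum>j\<in>A. f j) = (\<Sum>j\<in>A. L g (f j))" for g and f :: "_ \<Rightarrow> ('j, 'k) weyl"
    by (induction A rule: infinite_finite_induct) (simp_all add: zero add)
  have "foldr L gs (\<Sum>j\<in>A. weyl_const (c j) * h j) =
      (\<Sum>j\<in>A. weyl_const (c j) * foldr L gs (h j))" for gs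
    by (induction gs) (simp_all add: L_sum scale)
  then show ?thesis by (simp add: word_op_def)
qed

lemma word_op_plus: "word_op (u + w) v = word_op u (word_op w v)"
  by (simp add: word_op_def plus_word_def)

lemma free_op_add: "free_op (a + b) v = free_op a v + free_op b v"
  unfolding free_op_def
  by (rule setsum_keys_plus_distrib) (simp_all add: weyl_const_add distrib_right)

lemma free_op_0: "free_op 0 v = 0"
  by (simp add: free_op_def)

lemma free_op_diff: "free_op (a - b) v = free_op a v - free_op b v"
  using free_op_add[of "a - b" b v] by simp

lemma free_op_single: "free_op (Poly_Mapping.single w c) v = weyl_const c * word_op w v"
  by (simp add: free_op_def)

lemma free_op_sum: "free_op (\<Sum>j\<in>A. a j) v = (\<Sum>j\<in>A. free_op (a j) v)"
  by (induction A rule: infinite_finite_induct) (simp_all add: free_op_add free_op_0)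

lemma free_op_mult: "free_op (a * b) v = free_op a (free_op b v)"
proof -
  have "a * b = (\<Sum>u\<in>Poly_Mapping.keys a. \<Sum>w\<in>Poly_Mapping.keys b.
      Poly_Mapping.single (u + w) (Poly_Mapping.lookup a u * Poly_Mapping.lookup b w))"
    by (subst sum_singles[of a], subst sum_singles[of b])
      (simp only: sum_distrib_left sum_distrib_right mult_single sum.swap[of _ "Poly_Mapping.keys b"])
  then have "free_op (a * b) v = (\<Sum>u\<in>Poly_Mapping.keys a. \<Sum>w\<in>Poly_Mapping.keys b.
      weyl_const (Poly_Mapping.lookup a u * Poly_Mapping.lookup b w) * word_op u (word_op w v))"
    by (simp only: free_op_sum free_op_single word_op_plus)
  also have "\<dots> = (\<Sum>u\<in>Poly_Mapping.keys a. weyl_const (Poly_Mapping.lookup a u) * word_op u (free_op b v))"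
    unfolding free_op_def[of b] word_op_sum
    by (simp only: sum_distrib_left weyl_const_mult mult.assoc)
  finally show ?thesis by (simp only: free_op_def[of a])
qed

lemma free_op_const: "free_op (free_const c) v = weyl_const c * v"
  by (simp add: free_const_def free_op_single word_op_def zero_word_def)

lemma free_op_1: "free_op 1 v = v"
  using free_op_const[of 1 v] by (simp add: free_const_def)

lemma free_op_gen: "free_op (free_gen g) v = L g v"
  by (simp add: free_gen_def free_op_single word_op_def)

text \<open>The elements acting as zero form a two-sided ideal, and the relations imposed on
  \<open>L\<close> put the relators into it. This makes the action well defined on the
  quotient.\<close>

lemma free_op_ideal:
  assumes "a \<in> two_sided_ideal hull weyl_relators"
  shows "free_op a v = 0"
proof -
  let ?N = "{a. \<forall>v. free_op a v = 0}"
  have "free_op a v = 0" if "a \<in> weyl_relators" for a v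
    using that unfolding weyl_relators_def
    by (auto simp: commutator_def free_op_diff free_op_mult free_op_gen free_op_1 free_op_0 xx dd dx)
  moreover have "free_op a 0 = 0" for a
    using free_op_mult[of a 0 0] by (simp add: free_op_0)
  then have "two_sided_ideal ?N"
    by (simp add: two_sided_ideal_def left_ideal_def free_op_0 free_op_add free_op_mult)
  ultimately have "two_sided_ideal hull weyl_relators \<subseteq> ?N"
    by (intro hull_minimal) auto
  with assms show ?thesis by auto
qed

lemma weyl_op_abs: "weyl_op (abs_weyl a) v = free_op a v"
proof -
  have "abs_weyl (rep_weyl (abs_weyl a)) = abs_weyl a"
    by (rule Quotient_abs_rep[OF Quotient_weyl])
  then have "rep_weyl (abs_weyl a) - a \<in> two_sided_ideal hull weyl_relators"
    unfolding weyl.abs_eq_iff weyl_cong_def .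
  from free_op_ideal[OF this, of v] show ?thesis
    by (simp add: weyl_op_def free_op_diff)
qed

lemma weyl_op_add: "weyl_op (a + b) v = weyl_op a v + weyl_op b v"
  by (induction a, induction b) (simp add: plus_weyl.abs_eq weyl_op_abs free_op_add)

lemma weyl_op_diff: "weyl_op (a - b) v = weyl_op a v - weyl_op b v"
  using weyl_op_add[of "a - b" b v] by simp

lemma weyl_op_mult: "weyl_op (a * b) v = weyl_op a (weyl_op b v)"
  by (induction a, induction b) (simp add: times_weyl.abs_eq weyl_op_abs free_op_mult)

lemma weyl_op_const: "weyl_op (weyl_const c) v = weyl_const c * v"
  by (metis weyl_const.abs_eq weyl_op_abs free_op_const)

lemma weyl_op_gen: "weyl_op (weyl_x i) v = L (GX i) v" "weyl_op (weyl_d i) v = L (GD i) v"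
  by (simp_all add: weyl_x.abs_eq weyl_d.abs_eq weyl_op_abs free_op_gen)

lemma weyl_op_0 [simp]: "weyl_op 0 v = 0"
  using weyl_op_const[of 0] by simp

lemma weyl_op_1 [simp]: "weyl_op 1 v = v"
  using weyl_op_const[of 1] by simp

lemma weyl_op_zero_right [simp]: "weyl_op a 0 = 0"
  using weyl_op_mult[of a 0 0] by simp

text \<open>Used with \<open>v = 1\<close>: if generators of a left ideal kill 1, so does the whole
  ideal.\<close>

lemma left_ideal_annihilator: "left_ideal {a. weyl_op a v = 0}"
  by (simp add: left_ideal_def weyl_op_add weyl_op_mult)

end

section \<open>The criterion for properness\<close>

lemma left_ideal_proper_iff:
  assumes "left_ideal J"
  shows "J \<noteq> UNIV \<longleftrightarrow> 1 \<notin> J"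
  using left_idealD(3)[OF assms, of 1] by auto

theorem theorem3p11:
  fixes p q :: "'n::finite \<Rightarrow> ('n + 'n, 'k::field_char_0) weyl"
  assumes p: "\<And>i. p i \<in> subalgebra hull (range (\<lambda>i. weyl_x (Inl i)) \<union> range (\<lambda>i. weyl_d (Inl i)))"
    and q: "\<And>i. q i \<in> subalgebra hull (range (\<lambda>i. weyl_x (Inl i)) \<union> range (\<lambda>i. weyl_d (Inl i)))"
  shows "left_ideal hull
           (range (\<lambda>i. weyl_x (Inr i) - q i) \<union> range (\<lambda>i. weyl_d (Inr i) + p i)) \<noteq> UNIV \<longleftrightarrow>
         (\<forall>i j. commutator (q i) (q j) = 0 \<and> commutator (p i) (p j) = 0 \<and>
                commutator (p i) (q j) = (if i = j then 1 else 0))"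
proof -
  define H :: "('n + 'n) weyl_gen set" where "H = GX ` range Inl \<union> GD ` range Inl"
  define B :: "('n + 'n, 'k) weyl set" where "B = subalgebra hull (gen ` H)"
  define J where "J = left_ideal hull
    (range (\<lambda>i. weyl_x (Inr i) - q i) \<union> range (\<lambda>i. weyl_d (Inr i) + p i))"
  have B_eq: "B = subalgebra hull (range (\<lambda>i. weyl_x (Inl i)) \<union> range (\<lambda>i. weyl_d (Inl i)))"
    by (simp add: B_def H_def image_Un image_image)
  have pB: "p i \<in> B" and qB: "q i \<in> B" for i
    using p q by (simp_all add: B_eq)
  have const_B: "weyl_const c \<in> B" for c
    unfolding B_def using subalgebra_hull_closed(1) by (rule subsetD) simp
  have J: "left_ideal J"
    unfolding J_def by (rule left_ideal_hull)
  have qJ: "weyl_x (Inr i) - q i \<in> J" and pJ: "weyl_d (Inr i) + p i \<in> J" for i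
    unfolding J_def by (rule hull_inc, blast)+
  \<comment> \<open>Elements of \<open>B\<close> involve only the first pairs of variables, so the
    remaining variables commute with them.\<close>
  have comm: "weyl_x (Inr i) * b = b * weyl_x (Inr i)" "weyl_d (Inr i) * b = b * weyl_d (Inr i)"
    if b: "b \<in> B" for i b
  proof -
    obtain R where "b \<in> below H (\<lambda>_. 1) R"
      using subalgebra_subset_below[of "\<lambda>_. 1" b H] b by (auto simp: B_def)
    from gen_commutes_below[OF this[unfolded H_def], of "GX (Inr i)"]
      gen_commutes_below[OF this[unfolded H_def], of "GD (Inr i)"]
    show "weyl_x (Inr i) * b = b * weyl_x (Inr i)" "weyl_d (Inr i) * b = b * weyl_d (Inr i)"
      by auto
  qed
  have "(\<forall>i j. commutator (q i) (q j) = 0 \<and> commutator (p i) (p j) = 0 \<and>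
      commutator (p i) (q j) = (if i = j then 1 else 0))" if proper: "1 \<notin> J"
  proof -
    \<comment> \<open>The growth argument enters here: a proper \<open>J\<close> meets
      \<open>B\<close> only in 0.\<close>
    have zero: "b = 0" if "b \<in> J" "b \<in> B" for b
    proof (rule left_ideal_inter_subalgebra[OF J proper, of "range Inl"])
      show "CARD('n + 'n) = 2 * card (range (Inl :: 'n \<Rightarrow> 'n + 'n))"
        by (simp add: card_image)
      show "b \<in> J" "b \<in> subalgebra hull (gen ` (GX ` range Inl \<union> GD ` range Inl))"
        using that by (simp_all add: B_def H_def)
      fix g :: "('n + 'n) weyl_gen" assume g: "g \<notin> GX ` range Inl \<union> GD ` range Inl"
      have "\<exists>r\<in>B. gen g - r \<in> J"
      proof (cases g)
        case (GX j)
        with g obtain i where "j = Inr i" by (cases j) auto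
        with GX qB qJ show ?thesis by auto
      next
        case (GD j)
        with g obtain i where "j = Inr i" by (cases j) auto
        moreover have "- p i \<in> B"
          using subalgebra_hull_diff[of 0 "gen ` H" "p i"] pB const_B[of 0] by (simp add: B_def)
        ultimately show ?thesis
          using GD pJ by (intro bexI[of _ "- p i"]) simp_all
      qed
      then show "\<exists>r\<in>subalgebra hull (gen ` (GX ` range Inl \<union> GD ` range Inl)). gen g - r \<in> J"
        by (simp add: B_def H_def)
    qed
    have B_comm: "commutator a b \<in> B" if "a \<in> B" "b \<in> B" for a b
      using that unfolding B_def commutator_def
      by (intro subalgebra_hull_diff subalgebra_hull_closed)
    have J_comm: "commutator a b \<in> J" if "a \<in> J" "b \<in> J" for a b
      using that J unfolding commutator_def by (intro left_idealD)
    \<comment> \<open>By \<open>comm\<close> the brackets between the later variables and elements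
      of \<open>B\<close> vanish, so each of the three defects is a commutator of generators of
      \<open>J\<close>; it lies in \<open>J\<close> and in \<open>B\<close>.\<close>
    have "commutator (q i) (q j) = commutator (weyl_x (Inr i) - q i) (weyl_x (Inr j) - q j)" for i j
      using comm(1)[OF qB] by (simp add: commutator_def algebra_simps weyl_commutes(1))
    then have "commutator (q i) (q j) = 0" for i j
      using zero J_comm B_comm qB qJ by metis
    moreover have "commutator (p i) (p j) = commutator (weyl_d (Inr i) + p i) (weyl_d (Inr j) + p j)" for i j
      using comm(2)[OF pB] by (simp add: commutator_def algebra_simps weyl_commutes(2))
    then have "commutator (p i) (p j) = 0" for i j
      using zero J_comm B_comm pB pJ by metis
    moreover have "commutator (p i) (q j) = (if i = j then 1 else 0)" for i j
    proof -
      let ?\<delta> = "if i = j then 1 else 0 :: ('n + 'n, 'k) weyl"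
      have "?\<delta> - commutator (p i) (q j) =
          commutator (weyl_d (Inr i) + p i) (weyl_x (Inr j) - q j)"
        using comm(2)[OF qB] comm(1)[OF pB]
        by (simp add: commutator_def algebra_simps weyl_commutes(3))
      also have "\<dots> \<in> J"
        by (intro J_comm pJ qJ)
      finally have "?\<delta> - commutator (p i) (q j) \<in> J" .
      moreover have "?\<delta> \<in> B"
        using const_B[of 0] const_B[of 1] by simp
      then have "?\<delta> - commutator (p i) (q j) \<in> B"
        using B_comm[OF pB qB] unfolding B_def by (intro subalgebra_hull_diff)
      ultimately have "?\<delta> - commutator (p i) (q j) = 0"
        by (rule zero)
      then show ?thesis by simp
    qed
    ultimately show ?thesis by blast
  qed
  moreover have "1 \<notin> J" if rel: "\<forall>i j. commutator (q i) (q j) = 0 \<and> commutator (p i) (p j) = 0 \<and>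
      commutator (p i) (q j) = (if i = j then 1 else 0)"
  proof -
    \<comment> \<open>The algebra acts on itself: the first \<open>n\<close> pairs of variables from the left, the others
      through the \<open>q i\<close> and \<open>- p i\<close> from the right.\<close>
    define L :: "('n + 'n) weyl_gen \<Rightarrow> ('n + 'n, 'k) weyl \<Rightarrow> ('n + 'n, 'k) weyl" where
      "L g v = (case g of
         GX (Inl i) \<Rightarrow> weyl_x (Inl i) * v
       | GD (Inl i) \<Rightarrow> weyl_d (Inl i) * v
       | GX (Inr i) \<Rightarrow> v * q i
       | GD (Inr i) \<Rightarrow> - (v * p i))" for g v
    have L: "L (GX (Inl i)) v = weyl_x (Inl i) * v" "L (GD (Inl i)) v = weyl_d (Inl i) * v"
      "L (GX (Inr i)) v = v * q i" "L (GD (Inr i)) v = - (v * p i)" for i v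
      by (simp_all add: L_def)
    have rel: "q i * q j = q j * q i" "p i * p j = p j * p i"
      "p i * q j = q j * p i + (if i = j then 1 else 0)" for i j
      using rel by (auto simp: commutator_def algebra_simps)
    have "weyl_operators L"
    proof
      fix g u v c show "L g (u + v) = L g u + L g v"
        by (simp add: L_def distrib_left distrib_right split: weyl_gen.split sum.split)
      show "L g (weyl_const c * v) = weyl_const c * L g v"
        by (simp add: L_def mult.assoc weyl_const_central split: weyl_gen.split sum.split)
    next
      fix i j :: "'n + 'n" and v
      show "L (GX i) (L (GX j) v) = L (GX j) (L (GX i) v)"
        using weyl_commutes(1)[of i j, where ?'k = 'k]
        by (cases i; cases j) (simp_all add: L rel mult.assoc, simp flip: mult.assoc)
      show "L (GD i) (L (GD j) v) = L (GD j) (L (GD i) v)"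
        using weyl_commutes(2)[of i j, where ?'k = 'k]
        by (cases i; cases j) (simp_all add: L rel mult.assoc, simp flip: mult.assoc)
      \<comment> \<open>Left and right multiplications commute by associativity. Two right
        multiplications compose in reversed order, and the sign in \<open>- (v * p i)\<close>
        compensates for this.\<close>
      show "L (GD i) (L (GX j) v) = L (GX j) (L (GD i) v) + (if i = j then v else 0)"
      proof -
        have "weyl_d i * (weyl_x j * v) = weyl_x j * (weyl_d i * v) + (if i = j then v else 0)"
          by (simp add: weyl_commutes(3) distrib_right flip: mult.assoc)
        then show ?thesis
          by (cases i; cases j) (simp_all add: L rel mult.assoc distrib_left)
      qed
    qed
    then interpret weyl_operators L .
    \<comment> \<open>\<open>B\<close> acts by left multiplication because its generators
      do.\<close>
    have "subalgebra {b. \<forall>v. weyl_op b v = b * v}"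
      by (auto simp: subalgebra_def weyl_op_const weyl_op_add weyl_op_mult distrib_right mult.assoc)
    then have "B \<subseteq> {b. \<forall>v. weyl_op b v = b * v}"
      unfolding B_eq by (rule hull_minimal[rotated]) (auto simp: weyl_op_gen L)
    then have "weyl_op (p i) 1 = p i" "weyl_op (q i) 1 = q i" for i
      using pB[of i] qB[of i] by auto
    \<comment> \<open>The generators of \<open>J\<close> send 1 to \<open>q i - q i\<close> and
      \<open>- p i + p i\<close>, so all of \<open>J\<close> kills 1, whereas 1 acts as the
      identity.\<close>
    then have "J \<subseteq> {a. weyl_op a 1 = 0}"
      unfolding J_def
      by (intro hull_minimal left_ideal_annihilator) (auto simp: weyl_op_add weyl_op_diff weyl_op_gen L)
    then show ?thesis by auto
  qed
  ultimately have "1 \<notin> J \<longleftrightarrow> (\<forall>i j. commutator (q i) (q j) = 0 \<and> commutator (p i) (p j) = 0 \<and>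
      commutator (p i) (q j) = (if i = j then 1 else 0))"
    by blast
  then show ?thesis
    unfolding left_ideal_proper_iff[OF J, symmetric] unfolding J_def .
qed

end
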